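(* Let $R$ be a Noetherian normal domain whose divisor class group $\operatorname{Cl}(R) = \operatorname{Cl}(\operatorname{Spec}(R))$ is a finite abelian group of order $D$. Then for all ideals $\mathfrak{q} \subseteq R$ of pure height one, the symbolic power satisfies $\mathfrak{q}^{(Da)} \subseteq \mathfrak{q}^a$ for all integers $a > 0$.
   Context: All rings are commutative with identity. For a proper ideal $I$ of a Noetherian ring $R$ and an integer $a>0$, the $a$-th symbolic power is $I^{(a)} := I^a W^{-1}R \cap R$, where $W = R - \bigcup\{P : P \in \operatorname{Ass}_R(R/I)\}$ (the intersection with $R$ means the preimage in $R$). A proper ideal $I$ has pure height $h$ if all of its associated primes (the elements of $\operatorname{Ass}_R(R/I)$) have height $h$; in particular none are embedded. For a Noetherian normal domain $R$, the divisor class group $\operatorname{Cl}(R)$ is the free abelian group on the set of height one prime ideals of $R$ modulo the relations $a_1P_1 + \cdots + a_rP_r = 0$ whenever the ideal $P_1^{(a_1)} \cap \cdots \cap P_r^{(a_r)}$ (with $P_i$ height one primes and $a_i$ positive integers) is principal; this is the usual group of Weil divisors modulo principal divisors. *)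

theory Defs
  imports "HOL-Algebra.Algebra" "HOL-Library.Extended_Nat"
begin

section \<open>Localization\<close>

text \<open>
  The fraction \<open>r/s\<close> is the class of all \<open>(r', s')\<close> with \<open>u s' r = u s r'\<close> for some \<open>u\<close> in
  the multiplicative set; the factor \<open>u\<close> cannot be dropped when there are zero divisors.
\<close>

definition loc_frac :: "('a, 'b) ring_scheme \<Rightarrow> 'a set \<Rightarrow> 'a \<Rightarrow> 'a \<Rightarrow> ('a \<times> 'a) set" where
  "loc_frac R W r s = {(r', s'). r' \<in> carrier R \<and> s' \<in> W \<and>
     (\<exists>u\<in>W. u \<otimes>\<^bsub>R\<^esub> (s' \<otimes>\<^bsub>R\<^esub> r) = u \<otimes>\<^bsub>R\<^esub> (s \<otimes>\<^bsub>R\<^esub> r'))}"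

text \<open>
  Sum and product are written as unions over representatives, in the manner of
  \<^const>\<open>rcoset_mult\<close>; all members of each union coincide (see the computation rules below).
\<close>

definition localization :: "('a, 'b) ring_scheme \<Rightarrow> 'a set \<Rightarrow> ('a \<times> 'a) set ring" where
  "localization R W =
    \<lparr>carrier = {loc_frac R W r s | r s. r \<in> carrier R \<and> s \<in> W},
     monoid.mult = (\<lambda>A B. \<Union>(r, s)\<in>A. \<Union>(r', s')\<in>B. loc_frac R W (r \<otimes>\<^bsub>R\<^esub> r') (s \<otimes>\<^bsub>R\<^esub> s')),
     one = loc_frac R W \<one>\<^bsub>R\<^esub> \<one>\<^bsub>R\<^esub>,
     ring.zero = loc_frac R W \<zero>\<^bsub>R\<^esub> \<one>\<^bsub>R\<^esub>,
     ring.add = (\<lambda>A B. \<Union>(r, s)\<in>A. \<Union>(r', s')\<in>B.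
              loc_frac R W ((s' \<otimes>\<^bsub>R\<^esub> r) \<oplus>\<^bsub>R\<^esub> (s \<otimes>\<^bsub>R\<^esub> r')) (s \<otimes>\<^bsub>R\<^esub> s'))\<rparr>"

definition loc_map :: "('a, 'b) ring_scheme \<Rightarrow> 'a set \<Rightarrow> 'a \<Rightarrow> ('a \<times> 'a) set" where
  "loc_map R W r = loc_frac R W r \<one>\<^bsub>R\<^esub>"

definition frac_field :: "('a, 'b) ring_scheme \<Rightarrow> ('a \<times> 'a) set ring" where
  "frac_field R = localization R (carrier R - {\<zero>\<^bsub>R\<^esub>})"

locale mult_set = cring R + submonoid W R for R (structure) and W
begin

lemma W_carr: "s \<in> W \<Longrightarrow> s \<in> carrier R"
  using subset by blast

lemma loc_frac_eq_iff:
  assumes "a \<in> carrier R" "b \<in> carrier R" "s \<in> W" "t \<in> W"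
  shows "loc_frac R W a s = loc_frac R W b t \<longleftrightarrow> (\<exists>u\<in>W. u \<otimes> (t \<otimes> a) = u \<otimes> (s \<otimes> b))"
proof
  assume eq: "loc_frac R W a s = loc_frac R W b t"
  have "(b, t) \<in> loc_frac R W b t"
    using assms one_closed unfolding loc_frac_def by auto
  then have "(b, t) \<in> loc_frac R W a s" using eq by simp
  then show "\<exists>u\<in>W. u \<otimes> (t \<otimes> a) = u \<otimes> (s \<otimes> b)"
    unfolding loc_frac_def by auto
next
  have *: "loc_frac R W b t \<subseteq> loc_frac R W a s"
    if "a \<in> carrier R" "b \<in> carrier R" "s \<in> W" "t \<in> W" "u \<in> W"
      and u: "u \<otimes> (t \<otimes> a) = u \<otimes> (s \<otimes> b)" for a b s t u
  proof
    fix x assume "x \<in> loc_frac R W b t"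
    then obtain c r v where x: "x = (c, r)" and c: "c \<in> carrier R" "r \<in> W" "v \<in> W"
      and v: "v \<otimes> (r \<otimes> b) = v \<otimes> (t \<otimes> c)"
      unfolding loc_frac_def by auto
    note carr = that(1,2) c(1) that(3-5)[THEN W_carr] c(2,3)[THEN W_carr]
    have "(u \<otimes> v \<otimes> t) \<otimes> (r \<otimes> a) = (v \<otimes> r) \<otimes> (u \<otimes> (t \<otimes> a))"
      using carr by (simp add: m_ac)
    also have "\<dots> = (u \<otimes> s) \<otimes> (v \<otimes> (r \<otimes> b))"
      unfolding u using carr by (simp add: m_ac)
    also have "\<dots> = (u \<otimes> v \<otimes> t) \<otimes> (s \<otimes> c)"
      unfolding v using carr by (simp add: m_ac)
    finally have "(u \<otimes> v \<otimes> t) \<otimes> (r \<otimes> a) = (u \<otimes> v \<otimes> t) \<otimes> (s \<otimes> c)" .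
    moreover have "u \<otimes> v \<otimes> t \<in> W" using that c by (simp add: m_closed)
    ultimately show "x \<in> loc_frac R W a s"
      using x c unfolding loc_frac_def by blast
  qed
  assume "\<exists>u\<in>W. u \<otimes> (t \<otimes> a) = u \<otimes> (s \<otimes> b)"
  then obtain u where "u \<in> W" "u \<otimes> (t \<otimes> a) = u \<otimes> (s \<otimes> b)" by blast
  then show "loc_frac R W a s = loc_frac R W b t"
    using *[of a b s t u] *[of b a t s u] assms by auto
qed

lemma loc_frac_mem:
  assumes "a \<in> carrier R" "s \<in> W"
  shows "x \<in> loc_frac R W a s \<longleftrightarrow>
    (\<exists>b t. x = (b, t) \<and> b \<in> carrier R \<and> t \<in> W \<and> loc_frac R W b t = loc_frac R W a s)"
proof -
  obtain b t where x: "x = (b, t)" by (cases x)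
  have "x \<in> loc_frac R W a s \<longleftrightarrow> b \<in> carrier R \<and> t \<in> W \<and>
      (\<exists>u\<in>W. u \<otimes> (t \<otimes> a) = u \<otimes> (s \<otimes> b))"
    unfolding x loc_frac_def by auto
  also have "\<dots> \<longleftrightarrow> b \<in> carrier R \<and> t \<in> W \<and> loc_frac R W a s = loc_frac R W b t"
    using loc_frac_eq_iff[of a b s t] assms by blast
  finally show ?thesis unfolding x by auto
qed

lemma loc_frac_self: "a \<in> carrier R \<Longrightarrow> s \<in> W \<Longrightarrow> (a, s) \<in> loc_frac R W a s"
  using loc_frac_mem by blast

lemma loc_mult:
  assumes "a \<in> carrier R" "b \<in> carrier R" "s \<in> W" "t \<in> W"
  shows "loc_frac R W a s \<otimes>\<^bsub>localization R W\<^esub> loc_frac R W b t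
       = loc_frac R W (a \<otimes> b) (s \<otimes> t)"
proof -
  have "loc_frac R W (a' \<otimes> b') (s' \<otimes> t') = loc_frac R W (a \<otimes> b) (s \<otimes> t)"
    if A: "(a', s') \<in> loc_frac R W a s" and B: "(b', t') \<in> loc_frac R W b t" for a' s' b' t'
  proof -
    obtain u where u: "a' \<in> carrier R" "s' \<in> W" "u \<in> W" "u \<otimes> (s' \<otimes> a) = u \<otimes> (s \<otimes> a')"
      using A unfolding loc_frac_def by auto
    obtain v where v: "b' \<in> carrier R" "t' \<in> W" "v \<in> W" "v \<otimes> (t' \<otimes> b) = v \<otimes> (t \<otimes> b')"
      using B unfolding loc_frac_def by auto
    note carr = assms(1,2) u(1) v(1) assms(3,4)[THEN W_carr] u(2,3)[THEN W_carr] v(2,3)[THEN W_carr]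
    have "(u \<otimes> v) \<otimes> ((s \<otimes> t) \<otimes> (a' \<otimes> b')) = (u \<otimes> (s \<otimes> a')) \<otimes> (v \<otimes> (t \<otimes> b'))"
      using carr by (simp add: m_ac)
    also have "\<dots> = (u \<otimes> (s' \<otimes> a)) \<otimes> (v \<otimes> (t' \<otimes> b))" using u v by simp
    also have "\<dots> = (u \<otimes> v) \<otimes> ((s' \<otimes> t') \<otimes> (a \<otimes> b))" using carr by (simp add: m_ac)
    finally have "\<exists>w\<in>W. w \<otimes> ((s \<otimes> t) \<otimes> (a' \<otimes> b')) = w \<otimes> ((s' \<otimes> t') \<otimes> (a \<otimes> b))"
      by (rule bexI) (rule m_closed[OF u(3) v(3)])
    then show ?thesis
      by (subst loc_frac_eq_iff) (simp_all add: carr u(2) v(2) assms(3,4))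
  qed
  note const = this
  have "(\<Union>(a', s')\<in>loc_frac R W a s. \<Union>(b', t')\<in>loc_frac R W b t. loc_frac R W (a' \<otimes> b') (s' \<otimes> t'))
      = (\<Union>p\<in>loc_frac R W a s. \<Union>q\<in>loc_frac R W b t. loc_frac R W (a \<otimes> b) (s \<otimes> t))"
    unfolding case_prod_beta by (intro SUP_cong refl const) simp_all
  also have "\<dots> = loc_frac R W (a \<otimes> b) (s \<otimes> t)"
    using loc_frac_self[OF assms(1,3)] loc_frac_self[OF assms(2,4)] by blast
  finally show ?thesis by (simp add: localization_def)
qed

lemma loc_add:
  assumes "a \<in> carrier R" "b \<in> carrier R" "s \<in> W" "t \<in> W"
  shows "loc_frac R W a s \<oplus>\<^bsub>localization R W\<^esub> loc_frac R W b t
       = loc_frac R W ((t \<otimes> a) \<oplus> (s \<otimes> b)) (s \<otimes> t)"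
proof -
  have "loc_frac R W ((t' \<otimes> a') \<oplus> (s' \<otimes> b')) (s' \<otimes> t')
      = loc_frac R W ((t \<otimes> a) \<oplus> (s \<otimes> b)) (s \<otimes> t)"
    if A: "(a', s') \<in> loc_frac R W a s" and B: "(b', t') \<in> loc_frac R W b t" for a' s' b' t'
  proof -
    obtain u where u: "a' \<in> carrier R" "s' \<in> W" "u \<in> W" "u \<otimes> (s' \<otimes> a) = u \<otimes> (s \<otimes> a')"
      using A unfolding loc_frac_def by auto
    obtain v where v: "b' \<in> carrier R" "t' \<in> W" "v \<in> W" "v \<otimes> (t' \<otimes> b) = v \<otimes> (t \<otimes> b')"
      using B unfolding loc_frac_def by auto
    note carr = assms(1,2) u(1) v(1) assms(3,4)[THEN W_carr] u(2,3)[THEN W_carr] v(2,3)[THEN W_carr]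
    have "(u \<otimes> v) \<otimes> ((s \<otimes> t) \<otimes> ((t' \<otimes> a') \<oplus> (s' \<otimes> b')))
        = (v \<otimes> t \<otimes> t') \<otimes> (u \<otimes> (s \<otimes> a')) \<oplus> (u \<otimes> s \<otimes> s') \<otimes> (v \<otimes> (t \<otimes> b'))"
      using carr by (simp add: m_ac r_distr)
    also have "\<dots> = (v \<otimes> t \<otimes> t') \<otimes> (u \<otimes> (s' \<otimes> a)) \<oplus> (u \<otimes> s \<otimes> s') \<otimes> (v \<otimes> (t' \<otimes> b))"
      using u v by simp
    also have "\<dots> = (u \<otimes> v) \<otimes> ((s' \<otimes> t') \<otimes> ((t \<otimes> a) \<oplus> (s \<otimes> b)))"
      using carr by (simp add: m_ac r_distr)
    finally have "\<exists>w\<in>W. w \<otimes> ((s \<otimes> t) \<otimes> ((t' \<otimes> a') \<oplus> (s' \<otimes> b'))) = w \<otimes> ((s' \<otimes> t') \<otimes> ((t \<otimes> a) \<oplus> (s \<otimes> b)))"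
      by (rule bexI) (rule m_closed[OF u(3) v(3)])
    then show ?thesis
      by (subst loc_frac_eq_iff) (simp_all add: carr u(2) v(2) assms(3,4))
  qed
  note const = this
  have "(\<Union>(a', s')\<in>loc_frac R W a s. \<Union>(b', t')\<in>loc_frac R W b t. loc_frac R W ((t' \<otimes> a') \<oplus> (s' \<otimes> b')) (s' \<otimes> t'))
      = (\<Union>p\<in>loc_frac R W a s. \<Union>q\<in>loc_frac R W b t. loc_frac R W ((t \<otimes> a) \<oplus> (s \<otimes> b)) (s \<otimes> t))"
    unfolding case_prod_beta by (intro SUP_cong refl const) simp_all
  also have "\<dots> = loc_frac R W ((t \<otimes> a) \<oplus> (s \<otimes> b)) (s \<otimes> t)"
    using loc_frac_self[OF assms(1,3)] loc_frac_self[OF assms(2,4)] by blast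
  finally show ?thesis by (simp add: localization_def)
qed

lemma loc_frac_eqI:
  assumes "a \<in> carrier R" "b \<in> carrier R" "s \<in> W" "t \<in> W" "t \<otimes> a = s \<otimes> b"
  shows "loc_frac R W a s = loc_frac R W b t"
  using assms one_closed by (subst loc_frac_eq_iff) auto

lemma carrier_loc:
  "carrier (localization R W) = {loc_frac R W r s | r s. r \<in> carrier R \<and> s \<in> W}"
  by (simp add: localization_def)

lemma one_loc: "\<one>\<^bsub>localization R W\<^esub> = loc_frac R W \<one> \<one>"
  by (simp add: localization_def)

lemma zero_loc: "\<zero>\<^bsub>localization R W\<^esub> = loc_frac R W \<zero> \<one>"
  by (simp add: localization_def)

lemma cring_localization: "cring (localization R W)"
proof (rule cringI)
  show "abelian_group (localization R W)"
  proof (rule abelian_groupI, goal_cases)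
    case (1 x y)
    then show ?case by (auto simp: carrier_loc loc_add W_carr) (metis W_carr a_closed m_closed ring.ring_simprules(5) ring_axioms)
  next
    case 2
    show ?case using one_closed zero_closed unfolding carrier_loc zero_loc by blast
  next
    case (3 x y z)
    then show ?case
      by (auto simp: carrier_loc loc_add W_carr intro!: loc_frac_eqI)
        (simp_all add: W_carr r_distr m_ac a_ac)
  next
    case (4 x y)
    then show ?case
      by (auto simp: carrier_loc loc_add W_carr intro!: loc_frac_eqI)
        (simp_all add: W_carr r_distr m_ac a_ac)
  next
    case (5 x)
    then show ?case
      by (auto simp: carrier_loc zero_loc loc_add W_carr)
  next
    case (6 x)
    then obtain r s where x: "x = loc_frac R W r s" "r \<in> carrier R" "s \<in> W"
      by (auto simp: carrier_loc)
    have "loc_frac R W (\<ominus> r) s \<oplus>\<^bsub>localization R W\<^esub> x = \<zero>\<^bsub>localization R W\<^esub>"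
      unfolding x(1) zero_loc using x
      using one_closed by (simp add: loc_add W_carr r_minus l_neg) (rule loc_frac_eqI; simp add: W_carr)
    moreover have "loc_frac R W (\<ominus> r) s \<in> carrier (localization R W)"
      unfolding carrier_loc using x a_inv_closed[OF x(2)] by blast
    ultimately show ?case by (rule bexI)
  qed
  show "comm_monoid (localization R W)"
  proof (rule comm_monoidI, goal_cases)
    case (1 x y)
    then show ?case by (auto simp: carrier_loc loc_mult) (metis m_closed ring.ring_simprules(5) ring_axioms)
  next
    case 2
    show ?case unfolding carrier_loc one_loc using one_closed W_carr[OF one_closed] by blast
  next
    case (3 x y z)
    then show ?case by (auto simp: carrier_loc loc_mult W_carr m_ac)
  next
    case (4 x)
    then show ?case by (auto simp: carrier_loc one_loc loc_mult W_carr)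
  next
    case (5 x y)
    then show ?case by (auto simp: carrier_loc loc_mult W_carr m_ac)
  qed
next
  let ?L = "localization R W"
  fix x y z
  assume "x \<in> carrier ?L" "y \<in> carrier ?L" "z \<in> carrier ?L"
  then obtain a b c r s t where
    xyz: "x = loc_frac R W a r" "y = loc_frac R W b s" "z = loc_frac R W c t"
    and abc: "a \<in> carrier R" "b \<in> carrier R" "c \<in> carrier R"
    and W: "r \<in> W" "s \<in> W" "t \<in> W"
    by (auto simp: carrier_loc)
  note carr = abc W[THEN W_carr]
  let ?n = "s \<otimes> a \<oplus> r \<otimes> b"
  have "(x \<oplus>\<^bsub>?L\<^esub> y) \<otimes>\<^bsub>?L\<^esub> z = loc_frac R W (?n \<otimes> c) (r \<otimes> s \<otimes> t)"
    using abc W carr by (simp add: xyz loc_add loc_mult)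
  also have "\<dots> = loc_frac R W (t \<otimes> (?n \<otimes> c)) (t \<otimes> (r \<otimes> s \<otimes> t))"
    using abc W carr by (intro loc_frac_eqI) (auto simp: m_ac)
  also have "t \<otimes> (?n \<otimes> c) = (s \<otimes> t) \<otimes> (a \<otimes> c) \<oplus> (r \<otimes> t) \<otimes> (b \<otimes> c)"
    using carr by (simp add: l_distr r_distr m_ac)
  also have "t \<otimes> (r \<otimes> s \<otimes> t) = (r \<otimes> t) \<otimes> (s \<otimes> t)"
    using carr by (simp add: m_ac)
  also have "loc_frac R W ((s \<otimes> t) \<otimes> (a \<otimes> c) \<oplus> (r \<otimes> t) \<otimes> (b \<otimes> c)) ((r \<otimes> t) \<otimes> (s \<otimes> t))
      = x \<otimes>\<^bsub>?L\<^esub> z \<oplus>\<^bsub>?L\<^esub> y \<otimes>\<^bsub>?L\<^esub> z"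
    using abc W carr by (simp add: xyz loc_add loc_mult)
  finally show "(x \<oplus>\<^bsub>?L\<^esub> y) \<otimes>\<^bsub>?L\<^esub> z = x \<otimes>\<^bsub>?L\<^esub> z \<oplus>\<^bsub>?L\<^esub> y \<otimes>\<^bsub>?L\<^esub> z" .
qed

lemma loc_map_hom: "loc_map R W \<in> ring_hom R (localization R W)"
proof (rule ring_hom_memI)
  show "loc_map R W x \<in> carrier (localization R W)" if "x \<in> carrier R" for x
    using that one_closed unfolding carrier_loc loc_map_def by blast
qed (use one_closed in \<open>auto simp: loc_map_def one_loc loc_add loc_mult\<close>)

end

lemma (in domain) mult_set_nonzero: "mult_set R (carrier R - {\<zero>})"
  by unfold_locales (auto simp: integral_iff)

lemma (in domain) field_frac_field: "field (frac_field R)"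
proof -
  interpret mult_set R "carrier R - {\<zero>}" by (rule mult_set_nonzero)
  interpret F: cring "frac_field R" unfolding frac_field_def by (rule cring_localization)
  have ne: "\<one>\<^bsub>frac_field R\<^esub> \<noteq> \<zero>\<^bsub>frac_field R\<^esub>"
    unfolding frac_field_def one_loc zero_loc
    by (subst loc_frac_eq_iff) (auto simp: integral_iff)
  have "\<exists>y\<in>carrier (frac_field R). x \<otimes>\<^bsub>frac_field R\<^esub> y = \<one>\<^bsub>frac_field R\<^esub>"
    if x: "x \<in> carrier (frac_field R)" "x \<noteq> \<zero>\<^bsub>frac_field R\<^esub>" for x
  proof -
    obtain r s where rs: "x = loc_frac R (carrier R - {\<zero>}) r s" "r \<in> carrier R"
      "s \<in> carrier R - {\<zero>}"
      using x(1) unfolding frac_field_def carrier_loc by auto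
    have r: "r \<in> carrier R - {\<zero>}"
    proof (rule ccontr)
      assume "r \<notin> carrier R - {\<zero>}"
      then have "r = \<zero>" using rs by blast
      then have "x = \<zero>\<^bsub>frac_field R\<^esub>"
        unfolding frac_field_def zero_loc rs(1) using rs by (intro loc_frac_eqI) auto
      then show False using x by simp
    qed
    have "x \<otimes>\<^bsub>frac_field R\<^esub> loc_frac R (carrier R - {\<zero>}) s r
        = loc_frac R (carrier R - {\<zero>}) (r \<otimes> s) (s \<otimes> r)"
      unfolding frac_field_def rs(1) using rs r by (intro loc_mult) auto
    also have "\<dots> = \<one>\<^bsub>frac_field R\<^esub>"
      unfolding frac_field_def one_loc using rs r
      by (intro loc_frac_eqI) (auto simp: m_ac integral_iff)
    finally have "x \<otimes>\<^bsub>frac_field R\<^esub> loc_frac R (carrier R - {\<zero>}) s r = \<one>\<^bsub>frac_field R\<^esub>" .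
    moreover have "loc_frac R (carrier R - {\<zero>}) s r \<in> carrier (frac_field R)"
      unfolding frac_field_def carrier_loc using rs r by blast
    ultimately show ?thesis by blast
  qed
  then have "carrier (frac_field R) - {\<zero>\<^bsub>frac_field R\<^esub>} \<subseteq> Units (frac_field R)"
    unfolding Units_def using F.m_comm by fastforce
  moreover have "\<zero>\<^bsub>frac_field R\<^esub> \<notin> Units (frac_field R)"
    using ne unfolding Units_def by auto
  ultimately have "Units (frac_field R) = carrier (frac_field R) - {\<zero>\<^bsub>frac_field R\<^esub>}"
    unfolding Units_def by auto
  then show ?thesis by (rule F.cring_fieldI)
qed


section \<open>Normal domains\<close>

text \<open>
  Elements of \<open>K\<close> that are roots of a monic polynomial over the subring \<open>A\<close>;
  \<^const>\<open>polynomial\<close> represents polynomials by coefficient lists, leading coefficient first.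
\<close>

definition integral_over :: "('a, 'b) ring_scheme \<Rightarrow> 'a set \<Rightarrow> 'a \<Rightarrow> bool" where
  "integral_over K A x \<longleftrightarrow>
     (\<exists>p. polynomial\<^bsub>K\<^esub> A p \<and> p \<noteq> [] \<and> lead_coeff p = \<one>\<^bsub>K\<^esub> \<and> ring.eval K p x = \<zero>\<^bsub>K\<^esub>)"

locale normal_domain = domain +
  assumes integrally_closed:
    "\<lbrakk> x \<in> carrier (frac_field R);
       integral_over (frac_field R) (loc_map R (carrier R - {\<zero>}) ` carrier R) x \<rbrakk>
     \<Longrightarrow> x \<in> loc_map R (carrier R - {\<zero>}) ` carrier R"


section \<open>Associated primes, height and symbolic powers\<close>

text \<open>\<open>m\<close> is an element of the \<open>R\<close>-module \<open>R/I\<close>, on which \<open>r\<close> acts through its coset.\<close>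

definition annihilator_Quot :: "('a, 'b) ring_scheme \<Rightarrow> 'a set \<Rightarrow> 'a set \<Rightarrow> 'a set" where
  "annihilator_Quot R I m =
     {r \<in> carrier R. (I +>\<^bsub>R\<^esub> r) \<otimes>\<^bsub>R Quot I\<^esub> m = \<zero>\<^bsub>R Quot I\<^esub>}"

lemma (in ideal) annihilator_Quot_rcos:
  assumes "x \<in> carrier R"
  shows "annihilator_Quot R I (I +> x) = {r \<in> carrier R. r \<otimes> x \<in> I}"
proof -
  have iff: "I +> y = I \<longleftrightarrow> y \<in> I" if "y \<in> carrier R" for y
    using that a_rcos_const a_rcos_self by blast
  have "(I +> r) \<otimes>\<^bsub>R Quot I\<^esub> (I +> x) = \<zero>\<^bsub>R Quot I\<^esub> \<longleftrightarrow> r \<otimes> x \<in> I" if "r \<in> carrier R" for r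
  proof -
    have "(I +> r) \<otimes>\<^bsub>R Quot I\<^esub> (I +> x) = I +> r \<otimes> x"
      using that assms by (simp add: FactRing_def rcoset_mult_add)
    then show ?thesis
      using iff[of "r \<otimes> x"] that assms by (simp add: FactRing_def)
  qed
  then show ?thesis
    unfolding annihilator_Quot_def by (intro Collect_cong conj_cong refl)
qed

definition Ass_Quot :: "('a, 'b) ring_scheme \<Rightarrow> 'a set \<Rightarrow> 'a set set" where
  "Ass_Quot R I = {P. primeideal P R \<and> (\<exists>m\<in>carrier (R Quot I). P = annihilator_Quot R I m)}"

definition height :: "('a, 'b) ring_scheme \<Rightarrow> 'a set \<Rightarrow> enat" where
  "height R P = Sup {enat n | n. \<exists>Q :: nat \<Rightarrow> 'a set.
     (\<forall>i\<le>n. primeideal (Q i) R) \<and> (\<forall>i<n. Q i \<subset> Q (Suc i)) \<and> Q n = P}"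

definition pure_height :: "('a, 'b) ring_scheme \<Rightarrow> enat \<Rightarrow> 'a set \<Rightarrow> bool" where
  "pure_height R h I \<longleftrightarrow>
     ideal I R \<and> I \<noteq> carrier R \<and> (\<forall>P\<in>Ass_Quot R I. height R P = h)"

definition ideal_power :: "('a, 'b) ring_scheme \<Rightarrow> 'a set \<Rightarrow> nat \<Rightarrow> 'a set" where
  "ideal_power R I a = I [^]\<^bsub>ideals_set R\<^esub> a"

definition symbolic_power :: "('a, 'b) ring_scheme \<Rightarrow> 'a set \<Rightarrow> nat \<Rightarrow> 'a set" where
  "symbolic_power R I a =
     (let W = carrier R - \<Union>(Ass_Quot R I) in
      {x \<in> carrier R.
         loc_map R W x \<in> genideal (localization R W) (loc_map R W ` ideal_power R I a)})"


section \<open>The divisor class group\<close>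

definition height_one_primes :: "('a, 'b) ring_scheme \<Rightarrow> 'a set set" where
  "height_one_primes R = {P. primeideal P R \<and> height R P = 1}"

text \<open>
  The intersection of the symbolic powers of order \<open>a\<^sub>i\<close> of \<open>P\<^sub>i\<close>, for the effective divisor
  \<open>c = a\<^sub>1 P\<^sub>1 + \<dots> + a\<^sub>r P\<^sub>r\<close> with distinct \<open>P\<^sub>i\<close>; the empty intersection is \<open>R\<close>.
\<close>

definition divisor_ideal :: "('a, 'b) ring_scheme \<Rightarrow> ('a set \<Rightarrow>\<^sub>0 int) \<Rightarrow> 'a set" where
  "divisor_ideal R c = carrier R \<inter>
     (\<Inter>P\<in>Poly_Mapping.keys c. symbolic_power R P (nat (Poly_Mapping.lookup c P)))"

definition principal_relations :: "('a, 'b) ring_scheme \<Rightarrow> ('a set \<Rightarrow>\<^sub>0 int) set" where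
  "principal_relations R =
     {c. Poly_Mapping.keys c \<subseteq> height_one_primes R \<and>
         (\<forall>P\<in>Poly_Mapping.keys c. Poly_Mapping.lookup c P > 0) \<and>
         principalideal (divisor_ideal R c) R}"

definition class_group :: "('a, 'b) ring_scheme \<Rightarrow> ('a set \<Rightarrow>\<^sub>0 int) set monoid" where
  "class_group R = free_Abelian_group (height_one_primes R) Mod
     generate (free_Abelian_group (height_one_primes R)) (principal_relations R)"

lemma comm_group_class_group: "comm_group (class_group R)"
proof -
  let ?F = "free_Abelian_group (height_one_primes R)"
  have "subgroup (generate ?F (principal_relations R)) ?F"
    by (rule group.generate_is_subgroup) (auto simp: principal_relations_def)
  then show ?thesis
    unfolding class_group_def
    by (intro comm_group.abelian_FactGroup abelian_free_Abelian_group)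
qed

end

theory Submission
  imports Defs
begin

text \<open>
  Let \<open>n\<^sub>P\<close> be the order of \<open>\<qq>\<close> at a height one prime \<open>P\<close>. The class of \<open>\<Sum> n\<^sub>P P\<close> is killed by \<open>D\<close>, so
  there is \<open>h\<close> with \<open>v\<^sub>P(h) = D n\<^sub>P\<close> for all \<open>P\<close>. Since \<open>\<qq>\<close> is determined by its localizations at its
  associated primes, \<open>h \<in> \<qq>\<close>. An element \<open>x\<close> of \<open>\<qq>\<^sup>(\<^sup>D\<^sup>a\<^sup>)\<close> has \<open>v\<^sub>P(x) \<ge> a D n\<^sub>P = v\<^sub>P(h\<^sup>a)\<close> for all \<open>P\<close>, so
  \<open>h\<^sup>a\<close> divides \<open>x\<close> and \<open>x \<in> \<qq>\<^sup>a\<close>. The valuations are built without localizing: at a height one prime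
  there are \<open>y \<in> P\<close> and \<open>s \<notin> P\<close> with \<open>sP \<subseteq> (y)\<close>.
\<close>

text \<open>Membership in \<qq> can be tested at its associated primes, but membership in a power of
  \<qq> cannot: that power may have embedded primes, and this is what separates it from the symbolic
  power. So one element \<open>h\<close> of \<qq> is sought whose \<open>a\<close>-th power, a
  genuine product, divides everything in the symbolic power. Its orders must be large enough for
  membership in \<qq> and small enough for this divisibility; the factor \<open>D\<close> meets both
  demands because \<open>D\<close> is at least 1. A relation of the class group says only that some
  intersection of symbolic powers is principal. Reading off the orders of a generator requires
  elements of the intersection whose order at one chosen prime is exact; they exist because distinct
  height one primes are incomparable. Normality enters only through complete integral closedness. It
  is applied twice, to iterated multiplication by a fraction: once to produce uniformizers, once to
  show that a nonzero element cannot be divided by a uniformizer forever.\<close>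

no_notation Sum_Type.Plus (infixr \<open><+>\<close> 65)

subsection \<open>Noetherian rings and associated primes\<close>

lemma (in noetherian_ring) maximal_ideal_in:
  assumes "S \<noteq> {}" "\<And>I. I \<in> S \<Longrightarrow> ideal I R"
  obtains M where "M \<in> S" "\<And>J. J \<in> S \<Longrightarrow> M \<subseteq> J \<Longrightarrow> J = M"
proof -
  have "\<exists>M\<in>S. \<forall>J\<in>S. M \<subseteq> J \<longrightarrow> J = M"
  proof (rule subset_Zorn_nonempty[OF assms(1)])
    fix C assume C: "C \<noteq> {}" "subset.chain S C"
    then have "subset.chain {I. ideal I R} C"
      using assms(2) by (auto simp: pred_on.chain_def)
    then have "\<Union>C \<in> C" using ideal_chain_is_trivial C(1) by blast
    then show "\<Union>C \<in> S" using C(2) by (auto simp: pred_on.chain_def)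
  qed
  then show ?thesis using that by blast
qed

lemma (in noetherian_ring) increasing_ideals_stabilize:
  assumes "\<And>n. ideal (J n) R" "\<And>n::nat. J n \<subseteq> J (Suc n)"
  shows "\<exists>n. J (Suc n) = J n"
proof -
  obtain M where M: "M \<in> range J" "\<And>I. I \<in> range J \<Longrightarrow> M \<subseteq> I \<Longrightarrow> I = M"
    using maximal_ideal_in[of "range J"] assms(1) by blast
  then obtain n where "M = J n" by blast
  then show ?thesis using M(2)[of "J (Suc n)"] assms(2)[of n] by blast
qed

text \<open>The ideal quotient (I : x), which is the annihilator of the coset of \<open>x\<close> in
  R/I. It allows associated primes to be handled by elements of \<open>R\<close>.\<close>

definition colon :: "('a, 'b) ring_scheme \<Rightarrow> 'a set \<Rightarrow> 'a \<Rightarrow> 'a set" where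
  "colon R I x = {r \<in> carrier R. r \<otimes>\<^bsub>R\<^esub> x \<in> I}"

context cring
begin

no_notation Sum_Type.Plus (infixr \<open><+>\<close> 65)

lemma colon_ideal:
  assumes "ideal I R" "x \<in> carrier R"
  shows "ideal (colon R I x) R"
proof -
  interpret I: ideal I R by fact
  show ?thesis
  proof (rule idealI[OF ring_axioms])
    show "subgroup (colon R I x) (add_monoid R)"
    proof (unfold_locales, goal_cases)
      case 1 then show ?case by (auto simp: colon_def)
    next
      case (2 a b) then show ?case using assms by (auto simp: colon_def l_distr)
    next
      case 3 then show ?case using assms by (auto simp: colon_def)
    next
      case (4 a)
      then have "(\<ominus> a) \<otimes> x \<in> I" using assms by (auto simp: colon_def l_minus)
      then show ?case using 4 by (auto simp: colon_def a_inv_def[symmetric])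
    qed
  next
    fix a r assume a: "a \<in> colon R I x" and r: "r \<in> carrier R"
    then have "r \<otimes> (a \<otimes> x) \<in> I" by (auto simp: colon_def I.I_l_closed)
    then show "r \<otimes> a \<in> colon R I x" using a r assms(2) by (auto simp: colon_def m_assoc)
    then show "a \<otimes> r \<in> colon R I x" using a r by (auto simp: colon_def m_comm)
  qed
qed

lemma colon_mono_mult:
  assumes "ideal I R" "x \<in> carrier R" "c \<in> carrier R"
  shows "colon R I x \<subseteq> colon R I (x \<otimes> c)"
  using assms ideal.I_r_closed[OF assms(1) _ assms(3)] by (auto simp: colon_def m_assoc[symmetric])

lemma Ass_Quot_iff:
  assumes "ideal I R"
  shows "P \<in> Ass_Quot R I \<longleftrightarrow> primeideal P R \<and> (\<exists>x\<in>carrier R. P = colon R I x)"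
proof -
  interpret I: ideal I R by fact
  have "carrier (R Quot I) = {I +> x | x. x \<in> carrier R}"
    by (auto simp: FactRing_def A_RCOSETS_def')
  then show ?thesis
    unfolding Ass_Quot_def colon_def using I.annihilator_Quot_rcos by auto
qed

lemma Ass_Quot_prime: "P \<in> Ass_Quot R I \<Longrightarrow> primeideal P R"
  by (auto simp: Ass_Quot_def)

lemma Ass_Quot_contains:
  assumes "ideal I R" "P \<in> Ass_Quot R I"
  shows "I \<subseteq> P"
proof -
  interpret I: ideal I R by fact
  show ?thesis using assms(2) I.I_r_closed I.a_Hcarr by (auto simp: Ass_Quot_iff[OF assms(1)] colon_def)
qed

lemma prime_complement_submonoid:
  assumes "primeideal P R"
  shows "submonoid (carrier R - P) R"
proof -
  interpret primeideal P R by fact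
  show ?thesis using I_notcarr one_imp_carrier I_prime by unfold_locales auto
qed

lemma prime_nat_pow_mem:
  assumes "primeideal P R" "a \<in> carrier R" "a [^] (n::nat) \<in> P"
  shows "a \<in> P"
proof -
  interpret primeideal P R by fact
  show ?thesis
    using assms(3)
  proof (induction n)
    case 0
    then show ?case using one_imp_carrier I_notcarr by simp
  next
    case (Suc n)
    then show ?case using I_prime[of "a [^] n" a] assms(2) by auto
  qed
qed

lemma Ass_complement_submonoid: "submonoid (carrier R - \<Union>(Ass_Quot R I)) R"
proof -
  have "submonoid (carrier R - P) R" if "P \<in> Ass_Quot R I" for P
    using that prime_complement_submonoid Ass_Quot_prime by blast
  then show ?thesis unfolding submonoid_def by auto
qed

end

text \<open>
  A maximal element of the family of all \<open>I : xc\<close> disjoint from \<open>T\<close> is prime. The relevant cases are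
  \<open>T = {1}\<close> and the complement of a prime ideal.
\<close>

lemma (in noetherian_ring) Ass_Quot_disjoint:
  assumes "cring R" "ideal I R" "x \<in> carrier R" "submonoid T R" "colon R I x \<inter> T = {}"
  obtains Q where "Q \<in> Ass_Quot R I" "colon R I x \<subseteq> Q" "Q \<inter> T = {}"
proof -
  interpret cring R by fact
  interpret T: submonoid T R by fact
  interpret I: ideal I R by fact
  define S where "S = {colon R I (x \<otimes> c) | c. c \<in> carrier R \<and> colon R I (x \<otimes> c) \<inter> T = {}}"
  have "colon R I x \<in> S" unfolding S_def using assms(3,5) by (auto intro!: exI[of _ \<one>])
  moreover have "ideal J R" if "J \<in> S" for J
    using that assms(2,3) colon_ideal unfolding S_def by blast
  ultimately obtain M where M: "M \<in> S" "\<And>J. J \<in> S \<Longrightarrow> M \<subseteq> J \<Longrightarrow> J = M"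
    using maximal_ideal_in[of S] by blast
  then obtain c where c: "c \<in> carrier R" "M = colon R I (x \<otimes> c)" "M \<inter> T = {}"
    unfolding S_def by blast
  have larger: "colon R I (x \<otimes> (c \<otimes> d)) = M"
    if d: "d \<in> carrier R" and dis: "colon R I (x \<otimes> (c \<otimes> d)) \<inter> T = {}" for d
  proof (rule M(2))
    show "colon R I (x \<otimes> (c \<otimes> d)) \<in> S" unfolding S_def using c d dis by blast
    show "M \<subseteq> colon R I (x \<otimes> (c \<otimes> d))"
      unfolding c(2) using colon_mono_mult[OF assms(2) _ d, of "x \<otimes> c"] assms(3) c(1) d
      by (simp add: m_assoc)
  qed
  have "primeideal M R"
  proof (rule primeidealI[OF _ assms(1)])
    show "ideal M R" unfolding c(2) using colon_ideal assms(2,3) c(1) by blast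
    show "carrier R \<noteq> M" using c(3) by auto
    fix u v assume u: "u \<in> carrier R" and v: "v \<in> carrier R" and uv: "u \<otimes> v \<in> M"
    \<comment> \<open>If \<open>I : xcu\<close> avoids \<open>T\<close>, it equals \<open>M\<close>
      by maximality, and it contains \<open>v\<close>. Otherwise some \<open>t\<close> in
      \<open>T\<close> satisfies \<open>tu \<in> M\<close>. Then \<open>I : xct\<close> avoids
      \<open>T\<close>, since an \<open>r\<close> in both would put \<open>rt\<close> into
      \<open>M\<close> and \<open>T\<close>; so \<open>I : xct\<close> equals \<open>M\<close>, and
      it contains \<open>u\<close>.\<close>
    show "u \<in> M \<or> v \<in> M"
    proof (cases "colon R I (x \<otimes> (c \<otimes> u)) \<inter> T = {}")
      case True
      have "v \<in> colon R I (x \<otimes> (c \<otimes> u))"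
        using uv u v c(1) assms(3) unfolding c(2) colon_def by (auto simp: m_ac)
      then show ?thesis using larger[OF u True] by blast
    next
      case False
      then obtain t where t: "t \<in> T" "t \<in> carrier R" "t \<otimes> (x \<otimes> (c \<otimes> u)) \<in> I"
        by (auto simp: colon_def)
      have "colon R I (x \<otimes> (c \<otimes> t)) \<inter> T = {}"
      proof (rule ccontr)
        assume "colon R I (x \<otimes> (c \<otimes> t)) \<inter> T \<noteq> {}"
        then obtain r where r: "r \<in> T" "r \<in> carrier R" "r \<otimes> (x \<otimes> (c \<otimes> t)) \<in> I"
          by (auto simp: colon_def)
        then have "r \<otimes> t \<in> M \<inter> T"
          using t c(1) assms(3) unfolding c(2) colon_def by (auto simp: m_ac)
        then show False using c(3) by blast
      qed
      then have "colon R I (x \<otimes> (c \<otimes> t)) = M" using larger t(2) by blast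
      moreover have "u \<in> colon R I (x \<otimes> (c \<otimes> t))"
        using t u c(1) assms(3) by (auto simp: colon_def m_ac)
      ultimately show ?thesis by blast
    qed
  qed
  then have "M \<in> Ass_Quot R I" using Ass_Quot_iff[OF assms(2)] c assms(3) by blast
  moreover have "colon R I x \<subseteq> M" unfolding c(2) using colon_mono_mult assms(2,3) c(1) by blast
  ultimately show ?thesis using that c(3) by blast
qed

section \<open>Local membership tests and height one primes in a Noetherian domain\<close>

context noetherian_domain
begin

no_notation Sum_Type.Plus (infixr \<open><+>\<close> 65)

text \<open>The contrapositive is the local membership test: \<open>x\<close> lies in
  \<open>I\<close> as soon as every associated prime \<open>Q\<close> admits a multiplier
  \<open>t\<close> outside \<open>Q\<close> with \<open>t \<otimes> x \<in> I\<close>.\<close>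

lemma Ass_Quot_not_mem:
  assumes "ideal I R" "x \<in> carrier R" "x \<notin> I"
  obtains Q where "Q \<in> Ass_Quot R I" "colon R I x \<subseteq> Q"
proof -
  have "submonoid {\<one>} R" by unfold_locales auto
  moreover have "colon R I x \<inter> {\<one>} = {}" using assms by (auto simp: colon_def)
  ultimately show ?thesis
    using Ass_Quot_disjoint[OF is_cring assms(1,2)] that by metis
qed

text \<open>The colon ideal of \<open>\<one>\<close> is \<open>I\<close> itself, and avoiding the
  complement of \<open>P\<close> means lying inside \<open>P\<close>.\<close>

lemma Ass_Quot_below_prime:
  assumes "ideal I R" "primeideal P R" "I \<subseteq> P"
  obtains Q where "Q \<in> Ass_Quot R I" "Q \<subseteq> P"
proof -
  interpret I: ideal I R by fact
  have "colon R I \<one> = I" by (auto simp: colon_def)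
  then have "colon R I \<one> \<inter> (carrier R - P) = {}" using assms(3) by auto
  then obtain Q where Q: "Q \<in> Ass_Quot R I" "Q \<inter> (carrier R - P) = {}"
    using Ass_Quot_disjoint[OF is_cring assms(1) one_closed prime_complement_submonoid[OF assms(2)]]
    by metis
  interpret Q: primeideal Q R using Ass_Quot_prime Q(1) by blast
  show ?thesis using that Q Q.a_subset by blast
qed

text \<open>Replaces the supremum over chains once and for all. A nonzero prime \<open>Q\<close>
  strictly below \<open>P\<close> gives the chain {0}, \<open>Q\<close>, \<open>P\<close> of length
  2, since {0} is prime in a domain; conversely, in a chain of length at least 2 ending at
  \<open>P\<close>, the term just below \<open>P\<close> lies strictly above another prime and so is
  nonzero.\<close>

lemma height_one_iff:
  "P \<in> height_one_primes R \<longleftrightarrow>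
     primeideal P R \<and> P \<noteq> {\<zero>} \<and> (\<forall>Q. primeideal Q R \<and> Q \<noteq> {\<zero>} \<and> Q \<subseteq> P \<longrightarrow> Q = P)"
proof -
  let ?C = "\<lambda>n (Q :: nat \<Rightarrow> 'a set). (\<forall>i\<le>n. primeideal (Q i) R) \<and> (\<forall>i<n. Q i \<subset> Q (Suc i)) \<and> Q n = P"
  let ?S = "{enat n | n. \<exists>Q. ?C n Q}"
  have chain: "enat n \<le> height R P" if "?C n Q" for n Q
    unfolding height_def using that by (intro Sup_upper CollectI exI[of _ n] exI[of _ Q]) auto
  have zero_in: "\<zero> \<in> Q" if "primeideal Q R" for Q
  proof -
    interpret primeideal Q R by fact
    show ?thesis by simp
  qed
  show ?thesis
  proof (cases "primeideal P R")
    case P: True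
    have "height R P = 1 \<longleftrightarrow> P \<noteq> {\<zero>} \<and> (\<forall>Q. primeideal Q R \<and> Q \<noteq> {\<zero>} \<and> Q \<subseteq> P \<longrightarrow> Q = P)"
    proof (intro iffI conjI allI impI notI)
      assume h: "height R P = 1" and "P = {\<zero>}"
      have "enat n \<le> 0" if "?C n Q" for n Q
      proof (cases n)
        case (Suc m)
        then have "Q m \<subset> {\<zero>}" "primeideal (Q m) R" using that \<open>P = {\<zero>}\<close> by auto
        then show ?thesis using zero_in by blast
      qed (simp add: zero_enat_def)
      then have "height R P \<le> 0" unfolding height_def by (intro Sup_least) blast
      then show False using h by simp
    next
      fix Q assume h: "height R P = 1" and Q: "primeideal Q R \<and> Q \<noteq> {\<zero>} \<and> Q \<subseteq> P"
      show "Q = P"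
      proof (rule ccontr)
        assume "Q \<noteq> P"
        define C where "C = (\<lambda>i::nat. if i = 0 then {\<zero>} else if i = 1 then Q else P)"
        have "{\<zero>} \<subset> Q" "Q \<subset> P" using Q zero_in[of Q] \<open>Q \<noteq> P\<close> by auto
        then have "?C 2 C" using Q P zeroprimeideal
          by (auto simp: C_def less_Suc_eq numeral_2_eq_2)
        then have "enat 2 \<le> height R P" by (rule chain)
        then show False using h by (simp add: one_enat_def)
      qed
    next
      assume "P \<noteq> {\<zero>} \<and> (\<forall>Q. primeideal Q R \<and> Q \<noteq> {\<zero>} \<and> Q \<subseteq> P \<longrightarrow> Q = P)"
      then have nz: "P \<noteq> {\<zero>}" and min: "\<And>Q. primeideal Q R \<Longrightarrow> Q \<noteq> {\<zero>} \<Longrightarrow> Q \<subseteq> P \<Longrightarrow> Q = P"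
        by blast+
      have "enat n \<le> 1" if "?C n Q" for n Q
      proof (rule ccontr)
        assume "\<not> enat n \<le> 1"
        then obtain m where m: "n = Suc (Suc m)"
          by (metis One_nat_def enat_ord_simps(1) le_Suc_eq le_zero_eq nat.exhaust one_enat_def zero_le)
        have "Q m \<subset> Q (Suc m)" "Q (Suc m) \<subset> P" "primeideal (Q m) R" "primeideal (Q (Suc m)) R"
          using that m by auto
        moreover from this have "Q (Suc m) \<noteq> {\<zero>}" using zero_in[of "Q m"] by auto
        ultimately show False using min[of "Q (Suc m)"] by auto
      qed
      then have "height R P \<le> 1" unfolding height_def by (intro Sup_least) blast
      moreover have "?C 1 (\<lambda>i. if i = 0 then {\<zero>} else P)"
        using P nz zeroprimeideal zero_in[OF P] by auto
      then have "enat 1 \<le> height R P" by (rule chain)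
      ultimately show "height R P = 1" by (simp add: one_enat_def)
    qed
    then show ?thesis using P by (simp add: height_one_primes_def)
  qed (simp add: height_one_primes_def)
qed

lemma height_one_nonzero: "P \<in> height_one_primes R \<Longrightarrow> P \<noteq> {\<zero>}"
  by (simp add: height_one_iff)

lemma height_one_subset_eq:
  assumes "P \<in> height_one_primes R" "Q \<in> height_one_primes R" "Q \<subseteq> P"
  shows "Q = P"
proof -
  have "\<And>Q. primeideal Q R \<Longrightarrow> Q \<noteq> {\<zero>} \<Longrightarrow> Q \<subseteq> P \<Longrightarrow> Q = P"
    using assms(1) by (simp add: height_one_iff)
  moreover have "primeideal Q R" "Q \<noteq> {\<zero>}" using assms(2) by (simp_all add: height_one_iff)
  ultimately show ?thesis using assms(3) .
qed

text \<open>Noetherian induction: a maximal counterexample \<open>M\<close> is not prime, and if \<open>ab \<in> M\<close> then every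
  prime over \<open>M\<close> contains \<open>M + (a)\<close> or \<open>M + (b)\<close>.\<close>

lemma finite_height_one_over:
  assumes "ideal I R" "I \<noteq> {\<zero>}"
  shows "finite {P \<in> height_one_primes R. I \<subseteq> P}"
proof (rule ccontr)
  define S where "S = {I. ideal I R \<and> I \<noteq> {\<zero>} \<and> infinite {P \<in> height_one_primes R. I \<subseteq> P}}"
  assume "infinite {P \<in> height_one_primes R. I \<subseteq> P}"
  then have "I \<in> S" using assms S_def by blast
  then obtain M where M: "M \<in> S" "\<And>J. J \<in> S \<Longrightarrow> M \<subseteq> J \<Longrightarrow> J = M"
    using maximal_ideal_in[of S] S_def by blast
  interpret M: ideal M R using M(1) S_def by blast
  have fin: "finite {P \<in> height_one_primes R. M <+> PIdl a \<subseteq> P}" if a: "a \<in> carrier R" "a \<notin> M" for a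
  proof -
    have id: "ideal (M <+> PIdl a) R" using add_ideals M.is_ideal cgenideal_ideal a(1) by blast
    interpret A: ideal "PIdl a" R using cgenideal_ideal a(1) by blast
    have "m \<oplus> \<zero> \<in> M <+> PIdl a" if "m \<in> M" for m
      using that A.zero_closed unfolding set_add_def' by blast
    then have sub: "M \<subseteq> M <+> PIdl a" using M.a_Hcarr by auto
    have "\<zero> \<oplus> a \<in> M <+> PIdl a"
      using M.zero_closed cgenideal_self[OF a(1)] unfolding set_add_def' by blast
    then have "a \<in> M <+> PIdl a" using a(1) by simp
    then have "M <+> PIdl a \<noteq> M" using a(2) by blast
    then have "M <+> PIdl a \<notin> S" using M(2) sub by blast
    moreover have "M <+> PIdl a \<noteq> {\<zero>}" using sub M(1) S_def M.zero_closed by blast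
    ultimately show ?thesis using id S_def by blast
  qed
  have inf: "infinite {P \<in> height_one_primes R. M \<subseteq> P}" and Mnz: "M \<noteq> {\<zero>}"
    using M(1) S_def by auto
  have "M \<noteq> carrier R"
  proof
    assume "M = carrier R"
    have "\<not> M \<subseteq> P" if "P \<in> height_one_primes R" for P
    proof -
      interpret P: primeideal P R using that by (simp add: height_one_primes_def)
      show ?thesis using \<open>M = carrier R\<close> P.I_notcarr P.a_subset by auto
    qed
    then have "{P \<in> height_one_primes R. M \<subseteq> P} = {}" by auto
    then show False using inf by (metis finite.emptyI)
  qed
  moreover have "\<not> primeideal M R"
  proof
    assume "primeideal M R"
    \<comment> \<open>A height one prime above the nonzero prime \<open>M\<close> equals
      \<open>M\<close> by minimality, so there would be at most one.\<close>
    then have "{P \<in> height_one_primes R. M \<subseteq> P} \<subseteq> {M}"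
      using Mnz by (auto simp: height_one_iff)
    then show False using inf finite_subset[of _ "{M}"] by simp
  qed
  ultimately obtain a b where ab: "a \<in> carrier R" "b \<in> carrier R" "a \<otimes> b \<in> M" "a \<notin> M" "b \<notin> M"
    using primeidealI[OF M.is_ideal is_cring] by metis
  have "{P \<in> height_one_primes R. M \<subseteq> P} \<subseteq>
      {P \<in> height_one_primes R. M <+> PIdl a \<subseteq> P} \<union> {P \<in> height_one_primes R. M <+> PIdl b \<subseteq> P}"
  proof
    fix P assume P: "P \<in> {P \<in> height_one_primes R. M \<subseteq> P}"
    then interpret P: primeideal P R by (simp add: height_one_primes_def)
    have "M <+> PIdl c \<subseteq> P" if "c \<in> P" for c
      using that P cgenideal_minimal[OF P.is_ideal] P.a_closed unfolding set_add_def' by blast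
    moreover have "a \<in> P \<or> b \<in> P" using P.I_prime ab P by blast
    ultimately show "P \<in> {P \<in> height_one_primes R. M <+> PIdl a \<subseteq> P} \<union> {P \<in> height_one_primes R. M <+> PIdl b \<subseteq> P}"
      using P by blast
  qed
  then show False using inf finite_subset[OF _ finite_UnI[OF fin[OF ab(1,4)] fin[OF ab(2,5)]]] by simp
qed

end

subsection \<open>Noetherian normal domains\<close>

locale noetherian_normal_domain = noetherian_domain R + normal_domain R for R (structure)
begin

text \<open>
  Complete integral closedness: \<open>x = a/b\<close> satisfies \<open>c\<^sub>0 x\<^sup>k \<in> R\<close> for all \<open>k\<close>. Stabilization of the
  ideals \<open>(c\<^sub>0, \<dots>, c\<^sub>n)\<close> makes \<open>x\<close> integral over \<open>R\<close>.
\<close>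

lemma completely_integrally_closed:
  assumes a: "a \<in> carrier R" and b: "b \<in> carrier R" "b \<noteq> \<zero>"
    and c: "\<And>k. c k \<in> carrier R" "c 0 \<noteq> \<zero>" "\<And>k::nat. a \<otimes> c k = b \<otimes> c (Suc k)"
  shows "b divides a"
proof -
  define U where "U = carrier R - {\<zero>}"
  interpret U: mult_set R U unfolding U_def by (rule mult_set_nonzero)
  define K where "K = frac_field R"
  have K_loc: "K = localization R U" by (simp add: K_def frac_field_def U_def)
  interpret K: field K unfolding K_def by (rule field_frac_field)
  define \<phi> where "\<phi> = loc_map R U"
  have hom: "\<phi> \<in> ring_hom R K" unfolding \<phi>_def K_loc by (rule U.loc_map_hom)
  interpret \<phi>: ring_hom_ring R K \<phi>
    using hom by (intro ring_hom_ringI2 ring_axioms K.ring_axioms)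
  define x where "x = loc_frac R U a b"
  have xK: "x \<in> carrier K"
    unfolding x_def K_loc U.carrier_loc using a b by (auto simp: U_def)
  have step: "\<phi> (c k) \<otimes>\<^bsub>K\<^esub> x = \<phi> (c (Suc k))" for k
  proof -
    have "\<phi> (c k) \<otimes>\<^bsub>K\<^esub> x = loc_frac R U (c k \<otimes> a) (\<one> \<otimes> b)"
      unfolding \<phi>_def loc_map_def x_def K_loc using a b c(1)
      by (intro U.loc_mult) (auto simp: U_def)
    also have "\<dots> = \<phi> (c (Suc k))"
      unfolding \<phi>_def loc_map_def using a b c
      by (intro U.loc_frac_eqI) (auto simp: U_def m_comm)
    finally show ?thesis .
  qed
  have pow: "\<phi> (c k) = \<phi> (c 0) \<otimes>\<^bsub>K\<^esub> x [^]\<^bsub>K\<^esub> k" for k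
    by (induction k) (simp_all add: c(1) xK K.m_assoc flip: step)
  \<comment> \<open>\<open>J n\<close> is the ideal generated by \<open>c 0\<close>, ...,
    \<open>c (n - 1)\<close>, so \<open>J (Suc n) = J n\<close> says that \<open>c n\<close> depends
    on the earlier terms.\<close>
  define J where "J = rec_nat {\<zero>} (\<lambda>n I. I <+> PIdl (c n))"
  have J_simps: "J 0 = {\<zero>}" "J (Suc n) = J n <+> PIdl (c n)" for n
    by (simp_all add: J_def)
  have J_ideal: "ideal (J n) R" for n
    by (induction n) (simp_all add: J_simps zeroideal add_ideals cgenideal_ideal c(1))
  have J_Suc: "J (Suc n) = {i \<oplus> r \<otimes> c n | i r. i \<in> J n \<and> r \<in> carrier R}" for n
    unfolding J_simps set_add_def' cgenideal_def by blast
  have J_mono: "J n \<subseteq> J (Suc n)" for n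
  proof
    fix i assume i: "i \<in> J n"
    then have "i = i \<oplus> \<zero> \<otimes> c n" using c(1) ideal.Icarr[OF J_ideal] by simp
    then show "i \<in> J (Suc n)" unfolding J_Suc using i by blast
  qed
  obtain n where n: "J (Suc n) = J n"
    using increasing_ideals_stabilize[of J] J_ideal J_mono by blast
  \<comment> \<open>The list \<open>p\<close> holds the coefficients of \<open>z\<close> with
    respect to the generators, highest index first. Fixing its length at exactly \<open>m\<close>,
    leading zeros allowed, ensures that a further head entry gets the power \<open>m\<close> of
    \<open>x\<close>.\<close>
  have J_eval: "\<exists>p. set p \<subseteq> \<phi> ` carrier R \<and> length p = m \<and> \<phi> z = \<phi> (c 0) \<otimes>\<^bsub>K\<^esub> K.eval p x"
    if "z \<in> J m" for m z
    using that
  proof (induction m arbitrary: z)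
    case 0
    then show ?case using c(1) by (auto simp: J_simps intro!: exI[of _ "[]"])
  next
    case (Suc m)
    then obtain i r where i: "i \<in> J m" "r \<in> carrier R" "z = i \<oplus> r \<otimes> c m"
      unfolding J_Suc by blast
    obtain p where p: "set p \<subseteq> \<phi> ` carrier R" "length p = m" "\<phi> i = \<phi> (c 0) \<otimes>\<^bsub>K\<^esub> K.eval p x"
      using Suc.IH[OF i(1)] by blast
    have pK: "K.eval p x \<in> carrier K" using p(1) xK by (intro K.eval_in_carrier) auto
    have "\<phi> z = \<phi> (c 0) \<otimes>\<^bsub>K\<^esub> K.eval p x \<oplus>\<^bsub>K\<^esub> \<phi> r \<otimes>\<^bsub>K\<^esub> (\<phi> (c 0) \<otimes>\<^bsub>K\<^esub> x [^]\<^bsub>K\<^esub> m)"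
      using i c(1) ideal.Icarr[OF J_ideal i(1)] by (simp add: p(3) flip: pow)
    also have "\<dots> = \<phi> (c 0) \<otimes>\<^bsub>K\<^esub> K.eval (\<phi> r # p) x"
      using c(1) i(2) xK pK p(2) by (simp add: K.r_distr K.m_ac K.a_comm)
    finally show ?case using p i(2) by (intro exI[of _ "\<phi> r # p"]) auto
  qed
  have "c n \<in> J (Suc n)"
    unfolding J_Suc using c(1) additive_subgroup.zero_closed[OF ideal.axioms(1)[OF J_ideal]]
    by (intro CollectI exI[of _ \<zero>] exI[of _ \<one>]) auto
  \<comment> \<open>The sign is chosen so that the relation reads \<open>c 0\<close> times (x^n +
    p(x)) equals zero, with a monic second factor.\<close>
  then have "\<ominus> c n \<in> J n"
    using n additive_subgroup.a_inv_closed[OF ideal.axioms(1)[OF J_ideal]] by blast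
  then obtain p where p: "set p \<subseteq> \<phi> ` carrier R" "length p = n"
    "\<phi> (\<ominus> c n) = \<phi> (c 0) \<otimes>\<^bsub>K\<^esub> K.eval p x"
    using J_eval by blast
  have pK: "K.eval p x \<in> carrier K" using p(1) xK by (intro K.eval_in_carrier) auto
  have eval: "K.eval (\<one>\<^bsub>K\<^esub> # p) x = x [^]\<^bsub>K\<^esub> n \<oplus>\<^bsub>K\<^esub> K.eval p x"
    using p(2) xK by simp
  have "\<phi> (c 0) \<otimes>\<^bsub>K\<^esub> K.eval (\<one>\<^bsub>K\<^esub> # p) x = \<phi> (c n) \<oplus>\<^bsub>K\<^esub> \<phi> (\<ominus> c n)"
    unfolding eval p(3) pow[of n] using c(1) xK pK by (simp add: K.r_distr)
  also have "\<dots> = \<zero>\<^bsub>K\<^esub>" using c(1) by (simp add: K.r_neg)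
  finally have prod: "\<phi> (c 0) \<otimes>\<^bsub>K\<^esub> K.eval (\<one>\<^bsub>K\<^esub> # p) x = \<zero>\<^bsub>K\<^esub>" .
  \<comment> \<open>Injectivity of \<open>R\<close> into its fraction field, in the form needed
    twice: to see that the image of \<open>c 0\<close> is nonzero, and to turn membership of
    \<open>x\<close> in \<open>R\<close> into divisibility.\<close>
  have eqD: "r \<otimes> s = d" if eq: "loc_frac R U d s = loc_frac R U r \<one>" "d \<in> carrier R" "r \<in> carrier R" "s \<in> U" for d r s
  proof -
    obtain u where "u \<in> U" "u \<otimes> (\<one> \<otimes> d) = u \<otimes> (s \<otimes> r)"
      using U.loc_frac_eq_iff[of d r s \<one>] eq U.one_closed by auto
    then have "d = s \<otimes> r" using m_lcancel[of u d "s \<otimes> r"] eq by (simp add: U_def)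
    then show ?thesis using eq by (simp add: U_def m_comm)
  qed
  have "\<phi> (c 0) \<noteq> \<zero>\<^bsub>K\<^esub>"
  proof
    assume "\<phi> (c 0) = \<zero>\<^bsub>K\<^esub>"
    then have "loc_frac R U (c 0) \<one> = loc_frac R U \<zero> \<one>"
      unfolding \<phi>_def loc_map_def K_loc U.zero_loc .
    then show False using eqD[of "c 0" \<one> \<zero>] c by (auto simp: U_def)
  qed
  moreover have "K.eval (\<one>\<^bsub>K\<^esub> # p) x \<in> carrier K" unfolding eval using xK pK by simp
  ultimately have root: "K.eval (\<one>\<^bsub>K\<^esub> # p) x = \<zero>\<^bsub>K\<^esub>"
    using prod K.integral[of "\<phi> (c 0)"] c(1) by auto
  have "\<one>\<^bsub>K\<^esub> \<in> \<phi> ` carrier R" by (metis \<phi>.hom_one image_eqI one_closed)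
  then have poly: "polynomial\<^bsub>K\<^esub> (\<phi> ` carrier R) (\<one>\<^bsub>K\<^esub> # p)"
    using p(1) by (simp add: polynomial_def)
  have "integral_over K (\<phi> ` carrier R) x"
    unfolding integral_over_def by (rule exI[of _ "\<one>\<^bsub>K\<^esub> # p"], intro conjI poly root) simp_all
  then have "x \<in> \<phi> ` carrier R"
    using integrally_closed[of x] xK by (simp add: K_def \<phi>_def U_def)
  then obtain r where r: "r \<in> carrier R" "loc_frac R U a b = loc_frac R U r \<one>"
    by (auto simp: x_def \<phi>_def loc_map_def)
  then have "a = b \<otimes> r" using eqD[of a b r] a b m_comm[of b r] by (simp add: U_def)
  then show ?thesis using r(1) by (auto simp: factor_def)
qed

end

text \<open>Says, inside \<open>R\<close>, that \<open>y\<close> generates the maximal ideal of the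
  localization at \<open>P\<close>, with one denominator \<open>s\<close> serving all of
  \<open>P\<close>.\<close>

definition uniformizer :: "('a, 'b) ring_scheme \<Rightarrow> 'a set \<Rightarrow> 'a \<Rightarrow> bool" where
  "uniformizer R P y \<longleftrightarrow>
     y \<in> P \<and> (\<exists>s\<in>carrier R - P. \<forall>p\<in>P. y divides\<^bsub>R\<^esub> (s \<otimes>\<^bsub>R\<^esub> p))"

section \<open>Construction of uniformizers and factorization by them\<close>

context noetherian_normal_domain
begin

lemma mem_PIdl_iff: "b \<in> carrier R \<Longrightarrow> x \<in> PIdl b \<longleftrightarrow> b divides x"
  by (auto simp: cgenideal_def factor_def m_comm)

text \<open>Write \<open>P\<close> as (b) : c; then \<open>g\<close> is multiplication by the
  fraction c/b on \<open>P\<close>. If \<open>g\<close> mapped \<open>P\<close> into itself, all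
  b(c/b)^k would lie in \<open>R\<close>, so \<open>b\<close> would divide \<open>c\<close> and
  \<open>\<one>\<close> would lie in \<open>P\<close>. Hence some \<open>y\<close> in
  \<open>P\<close> has \<open>g y\<close> outside \<open>P\<close>, and
  \<open>g y \<otimes> p = y \<otimes> g p\<close> makes \<open>y\<close> a uniformizer with
  multiplier \<open>g y\<close>.\<close>

lemma Ass_principal_uniformizer:
  assumes b: "b \<in> carrier R" "b \<noteq> \<zero>" and P: "P \<in> Ass_Quot R (PIdl b)"
  shows "\<exists>y. uniformizer R P y"
proof -
  interpret I: ideal "PIdl b" R using cgenideal_ideal b(1) .
  interpret P: primeideal P R using Ass_Quot_prime[OF P] .
  obtain c where c: "c \<in> carrier R" "P = colon R (PIdl b) c"
    using P Ass_Quot_iff[OF I.is_ideal] by blast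
  have "\<exists>q\<in>carrier R. p \<otimes> c = b \<otimes> q" if "p \<in> P" for p
    using that b(1) unfolding c(2) colon_def by (auto simp: mem_PIdl_iff factor_def)
  then obtain g where g: "\<And>p. p \<in> P \<Longrightarrow> g p \<in> carrier R" "\<And>p. p \<in> P \<Longrightarrow> p \<otimes> c = b \<otimes> g p"
    by metis
  have "\<exists>y\<in>P. g y \<notin> P"
  proof (rule ccontr)
    assume "\<not> (\<exists>y\<in>P. g y \<notin> P)"
    then have gP: "\<And>p. p \<in> P \<Longrightarrow> g p \<in> P" by blast
    have bP: "b \<in> P" using Ass_Quot_contains[OF I.is_ideal P] cgenideal_self[OF b(1)] by blast
    have in_P: "(g ^^ k) b \<in> P" for k by (induction k) (simp_all add: bP gP)
    have "b divides c"
    proof (rule completely_integrally_closed[where c = "\<lambda>k. (g ^^ k) b"])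
      show "(g ^^ k) b \<in> carrier R" for k using in_P P.Icarr by blast
      show "c \<otimes> (g ^^ k) b = b \<otimes> (g ^^ Suc k) b" for k
        using g(2)[OF in_P[of k]] m_comm[OF c(1) P.Icarr[OF in_P[of k]]] by simp
    qed (use b c in auto)
    then have "\<one> \<otimes> c \<in> PIdl b" unfolding mem_PIdl_iff[OF b(1)] l_one[OF c(1)] .
    then have "\<one> \<in> P" unfolding c(2) colon_def by blast
    then show False using P.one_imp_carrier P.I_notcarr by simp
  qed
  then obtain y where y: "y \<in> P" "g y \<notin> P" by blast
  have "y divides (g y \<otimes> p)" if p: "p \<in> P" for p
  proof -
    note carr = P.Icarr[OF y(1)] P.Icarr[OF p] g(1)[OF y(1)] g(1)[OF p] b(1) c(1)
    have "b \<otimes> (g y \<otimes> p) = (b \<otimes> g y) \<otimes> p" using carr by (simp add: m_assoc)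
    also have "\<dots> = y \<otimes> (p \<otimes> c)" unfolding g(2)[OF y(1), symmetric] using carr by (simp add: m_ac)
    also have "\<dots> = b \<otimes> (y \<otimes> g p)" unfolding g(2)[OF p] using carr by (simp add: m_ac)
    finally have "g y \<otimes> p = y \<otimes> g p" using m_lcancel[of b] b carr by auto
    then show ?thesis using g(1)[OF p] by (auto simp: factor_def)
  qed
  then show ?thesis unfolding uniformizer_def using y g(1)[OF y(1)] by blast
qed

text \<open>For nonzero \<open>b\<close> in \<open>P\<close>, some prime associated to (b) lies in
  \<open>P\<close>; it is nonzero because it contains \<open>b\<close>, so it is \<open>P\<close> by
  minimality.\<close>

lemma height_one_uniformizer:
  assumes "P \<in> height_one_primes R"
  shows "\<exists>y. uniformizer R P y"
proof -
  interpret P: primeideal P R using assms height_one_iff by blast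
  have "P \<noteq> {\<zero>}" using assms height_one_iff by blast
  then obtain b where b: "b \<in> P" "b \<noteq> \<zero>" using P.zero_closed by blast
  then obtain Q where Q: "Q \<in> Ass_Quot R (PIdl b)" "Q \<subseteq> P"
    using Ass_Quot_below_prime[of "PIdl b" P] P.primeideal cgenideal_ideal P.Icarr
      cgenideal_minimal[OF P.is_ideal] by metis
  have "b \<in> Q" using Ass_Quot_contains[OF _ Q(1)] cgenideal_ideal cgenideal_self P.Icarr b by blast
  then have "Q = P" using Ass_Quot_prime[OF Q(1)] Q(2) b(2) assms height_one_iff by blast
  then show ?thesis using Ass_principal_uniformizer Q(1) b P.Icarr by blast
qed

text \<open>Here \<open>g\<close> is multiplication by s/y on \<open>P\<close>. If the iterates of
  \<open>f\<close> never left \<open>P\<close>, all f(s/y)^k would lie in \<open>R\<close>, so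
  \<open>y\<close> would divide \<open>s\<close>, which is impossible for \<open>y\<close> in
  \<open>P\<close> and \<open>s\<close> outside. The first iterate outside \<open>P\<close> is
  \<open>u\<close>, and \<open>t\<close> is the matching power of \<open>s\<close>. This takes the
  place of Krull's intersection theorem.\<close>

lemma uniformizer_factorization:
  assumes "primeideal P R" "uniformizer R P y" "f \<in> carrier R" "f \<noteq> \<zero>"
  shows "\<exists>n. \<exists>t\<in>carrier R - P. \<exists>u\<in>carrier R - P. t \<otimes> f = y [^] (n::nat) \<otimes> u"
proof -
  interpret P: primeideal P R by fact
  obtain s where s: "s \<in> carrier R - P" "\<And>p. p \<in> P \<Longrightarrow> y divides (s \<otimes> p)" and yP: "y \<in> P"
    using assms(2) unfolding uniformizer_def by blast
  have y: "y \<in> carrier R" using yP P.Icarr by blast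
  have "\<exists>q\<in>carrier R. s \<otimes> p = y \<otimes> q" if "p \<in> P" for p
    using s(2)[OF that] by (auto simp: factor_def)
  then obtain g where g: "\<And>p. p \<in> P \<Longrightarrow> g p \<in> carrier R" "\<And>p. p \<in> P \<Longrightarrow> s \<otimes> p = y \<otimes> g p"
    by metis
  have "\<exists>n. (g ^^ n) f \<notin> P"
  proof (rule ccontr)
    assume "\<not> (\<exists>n. (g ^^ n) f \<notin> P)"
    then have in_P: "(g ^^ k) f \<in> P" for k by blast
    have "y \<noteq> \<zero>"
    proof
      assume "y = \<zero>"
      then have "s \<otimes> f = \<zero>" using g[OF in_P[of 0]] by simp
      then show False using s(1) assms(3,4) integral[of s f] P.zero_closed by auto
    qed
    have "y divides s"
    proof (rule completely_integrally_closed[where c = "\<lambda>k. (g ^^ k) f"])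
      show "(g ^^ k) f \<in> carrier R" for k using in_P P.Icarr by blast
      show "s \<otimes> (g ^^ k) f = y \<otimes> (g ^^ Suc k) f" for k using g(2)[OF in_P[of k]] by simp
    qed (use y s \<open>y \<noteq> \<zero>\<close> assms in auto)
    then show False using s(1) yP P.I_r_closed by (auto simp: factor_def)
  qed
  then obtain n where n: "(g ^^ n) f \<notin> P" "\<And>k. k < n \<Longrightarrow> (g ^^ k) f \<in> P"
    using exists_least_iff[of "\<lambda>n. (g ^^ n) f \<notin> P"] by blast
  have fac: "(g ^^ k) f \<in> carrier R \<and> s [^] k \<otimes> f = y [^] k \<otimes> (g ^^ k) f" if "k \<le> n" for k
    using that
  proof (induction k)
    case 0
    then show ?case using assms(3) by simp
  next
    case (Suc k)
    have in_P: "(g ^^ k) f \<in> P" using Suc n(2) by simp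
    note carr = Suc.prems P.Icarr[OF in_P] g(1)[OF in_P] y
    have sc: "s \<in> carrier R" using s(1) by blast
    have "s [^] Suc k \<otimes> f = s \<otimes> (s [^] k \<otimes> f)" using sc assms(3) by (simp add: m_ac)
    also have "\<dots> = y [^] k \<otimes> (s \<otimes> (g ^^ k) f)" using Suc sc carr by (simp add: m_ac)
    also have "\<dots> = y [^] Suc k \<otimes> (g ^^ Suc k) f" using g[OF in_P] y by (simp add: m_ac)
    finally show ?case using carr by simp
  qed
  have "s [^] n \<in> carrier R - P" using s(1) prime_nat_pow_mem[OF assms(1), of s n] by auto
  then show ?thesis using fac[of n] n(1) by blast
qed

text \<open>Factoring a nonzero element of a smaller prime \<open>Q\<close> puts \<open>y\<close>
  into \<open>Q\<close>, because \<open>u\<close> is outside \<open>P\<close>. Then \<open>s\<close>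
  times \<open>P\<close> lies in \<open>Q\<close> with \<open>s\<close> outside \<open>Q\<close>, so
  \<open>P\<close> lies in \<open>Q\<close>.\<close>

lemma uniformizer_height_one:
  assumes "primeideal P R" "uniformizer R P y" "P \<noteq> {\<zero>}"
  shows "P \<in> height_one_primes R"
proof -
  interpret P: primeideal P R by fact
  obtain s where s: "s \<in> carrier R - P" "\<And>p. p \<in> P \<Longrightarrow> y divides (s \<otimes> p)" and yP: "y \<in> P"
    using assms(2) unfolding uniformizer_def by blast
  have y: "y \<in> carrier R" using yP P.Icarr by blast
  have "Q = P" if Q: "primeideal Q R" "Q \<noteq> {\<zero>}" "Q \<subseteq> P" for Q
  proof -
    interpret Q: primeideal Q R by fact
    obtain f where f: "f \<in> Q" "f \<noteq> \<zero>" using Q(2) Q.zero_closed by blast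
    then obtain n t u where tu: "t \<in> carrier R - P" "u \<in> carrier R - P" "t \<otimes> f = y [^] (n::nat) \<otimes> u"
      using uniformizer_factorization[OF assms(1,2)] Q.Icarr by blast
    have "y [^] n \<otimes> u \<in> Q" using tu f Q.I_l_closed by (metis DiffD1)
    then have "y [^] n \<in> Q" using Q.I_prime tu(2) y Q(3) by blast
    then have yQ: "y \<in> Q" using prime_nat_pow_mem[OF Q(1) y] by blast
    have "p \<in> Q" if p: "p \<in> P" for p
    proof -
      have "s \<otimes> p \<in> Q" using s(2)[OF p] yQ Q.I_r_closed by (auto simp: factor_def)
      then show ?thesis using Q.I_prime[of s p] s(1) Q(3) P.Icarr[OF p] by blast
    qed
    then show ?thesis using Q(3) by blast
  qed
  then show ?thesis using assms(1,3) height_one_iff by blast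
qed

text \<open>Nonzero principal ideals have no embedded primes, Serre's condition S2 for normal
  domains. This is what reduces divisibility to height one primes.\<close>

lemma Ass_principal_height_one:
  assumes "b \<in> carrier R" "b \<noteq> \<zero>" "P \<in> Ass_Quot R (PIdl b)"
  shows "P \<in> height_one_primes R"
proof -
  have "b \<in> P"
    using Ass_Quot_contains[OF cgenideal_ideal[OF assms(1)] assms(3)] cgenideal_self[OF assms(1)]
    by blast
  then show ?thesis
    using uniformizer_height_one Ass_Quot_prime[OF assms(3)] Ass_principal_uniformizer[OF assms]
      assms(2) by blast
qed

end


subsection \<open>Valuations at height one primes\<close>

definition unif :: "('a, 'b) ring_scheme \<Rightarrow> 'a set \<Rightarrow> 'a" where
  "unif R P = (SOME y. uniformizer R P y)"

text \<open>Meaningful only for a height one prime \<open>P\<close> and \<open>f \<noteq> 0\<close>.\<close>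

definition val :: "('a, 'b) ring_scheme \<Rightarrow> 'a set \<Rightarrow> 'a \<Rightarrow> nat" where
  "val R P f = (THE n. \<exists>t\<in>carrier R - P. \<exists>u\<in>carrier R - P.
     t \<otimes>\<^bsub>R\<^esub> f = unif R P [^]\<^bsub>R\<^esub> n \<otimes>\<^bsub>R\<^esub> u)"

text \<open>The contraction to \<open>R\<close> of the \<open>n\<close>-th power of the maximal
  ideal of the localization at \<open>P\<close>. Zero is put in by hand because
  \<open>val R P \<zero>\<close> carries no meaning.\<close>

definition val_ideal :: "('a, 'b) ring_scheme \<Rightarrow> 'a set \<Rightarrow> nat \<Rightarrow> 'a set" where
  "val_ideal R P n = {f \<in> carrier R. f = \<zero>\<^bsub>R\<^esub> \<or> n \<le> val R P f}"

lemma (in domain) nat_pow_nonzero: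
  "a \<in> carrier R \<Longrightarrow> a \<noteq> \<zero> \<Longrightarrow> a [^] (n::nat) \<noteq> \<zero>"
  by (induction n) (auto simp: integral_iff)

lemma (in cring) prime_complement_mult:
  assumes "primeideal P R" "s \<in> carrier R - P" "t \<in> carrier R - P"
  shows "s \<otimes> t \<in> carrier R - P"
  using submonoid.m_closed[OF prime_complement_submonoid[OF assms(1)] assms(2,3)] .

lemma (in cring) prime_complement_one: "primeideal P R \<Longrightarrow> \<one> \<in> carrier R - P"
  by (rule submonoid.one_closed[OF prime_complement_submonoid])

lemma (in cring) prime_complement_nonzero:
  assumes "primeideal P R" "s \<in> carrier R - P"
  shows "s \<noteq> \<zero>"
proof -
  interpret primeideal P R by fact
  show ?thesis using assms(2) zero_closed by auto
qed

context noetherian_normal_domain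
begin

lemma height_one_prime: "P \<in> height_one_primes R \<Longrightarrow> primeideal P R"
  by (simp add: height_one_primes_def)

lemma uniformizer_unif: "P \<in> height_one_primes R \<Longrightarrow> uniformizer R P (unif R P)"
  unfolding unif_def by (rule someI_ex) (rule height_one_uniformizer)

lemma unif_mem: "P \<in> height_one_primes R \<Longrightarrow> unif R P \<in> P"
  using uniformizer_unif by (auto simp: uniformizer_def)

lemma unif_carrier: "P \<in> height_one_primes R \<Longrightarrow> unif R P \<in> carrier R"
  by (rule ideal.Icarr[OF primeideal.axioms(1)[OF height_one_prime] unif_mem])

lemma unif_nonzero:
  assumes P: "P \<in> height_one_primes R"
  shows "unif R P \<noteq> \<zero>"
proof
  assume 0: "unif R P = \<zero>"
  interpret P: primeideal P R by (rule height_one_prime[OF P])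
  obtain s where s: "s \<in> carrier R - P" "\<And>p. p \<in> P \<Longrightarrow> unif R P divides (s \<otimes> p)"
    using uniformizer_unif[OF P] unfolding uniformizer_def by blast
  have "p = \<zero>" if p: "p \<in> P" for p
  proof -
    have "s \<otimes> p = \<zero>" using s(2)[OF p] unfolding 0 factor_def by auto
    then show ?thesis
      using integral[of s p] s(1) P.Icarr[OF p] prime_complement_nonzero[OF P.primeideal s(1)] by auto
  qed
  then have "P = {\<zero>}" using P.zero_closed by auto
  then show False using height_one_nonzero[OF P] by simp
qed

text \<open>Makes the \<open>THE\<close> in \<open>val\<close> legitimate: if two factorizations had
  different exponents, cross multiplying and cancelling the smaller power would leave an element
  outside \<open>P\<close> equal to a multiple of the uniformizer.\<close>

lemma val_eqI:
  assumes P: "P \<in> height_one_primes R" and f: "f \<in> carrier R"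
    and t: "t \<in> carrier R - P" and u: "u \<in> carrier R - P"
    and eq: "t \<otimes> f = unif R P [^] (n::nat) \<otimes> u"
  shows "val R P f = n"
proof -
  let ?\<pi> = "unif R P"
  note \<pi> = unif_carrier[OF P] and prime = height_one_prime[OF P]
  interpret P: primeideal P R by (rule prime)
  have not_less: "\<not> n < m"
    if t: "t \<in> carrier R - P" and u: "u \<in> carrier R - P" and eq: "t \<otimes> f = ?\<pi> [^] n \<otimes> u"
      and t': "t' \<in> carrier R - P" and u': "u' \<in> carrier R - P" and eq': "t' \<otimes> f = ?\<pi> [^] m \<otimes> u'"
    for t u t' u' and n m :: nat
  proof
    assume "n < m"
    then obtain k where m: "m = n + Suc k" using less_iff_Suc_add by auto
    have "?\<pi> [^] n \<otimes> (t' \<otimes> u) = t' \<otimes> (?\<pi> [^] n \<otimes> u)" using t' u \<pi> by (simp add: m_ac)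
    also have "\<dots> = t \<otimes> (t' \<otimes> f)" unfolding eq[symmetric] using t t' f by (simp add: m_ac)
    also have "\<dots> = ?\<pi> [^] n \<otimes> (t \<otimes> u' \<otimes> ?\<pi> [^] k \<otimes> ?\<pi>)"
      unfolding eq' m using t u' \<pi> by (simp add: m_ac flip: nat_pow_mult)
    finally have "t' \<otimes> u = t \<otimes> u' \<otimes> ?\<pi> [^] k \<otimes> ?\<pi>"
      using m_lcancel[of "?\<pi> [^] n"] nat_pow_nonzero[OF \<pi> unif_nonzero[OF P]] t t' u u' \<pi> by simp
    also have "\<dots> \<in> P" using P.I_l_closed[OF unif_mem[OF P]] t u' \<pi> by simp
    finally show False using prime_complement_mult[OF prime t' u] by simp
  qed
  show ?thesis
    unfolding val_def
  proof (rule the_equality)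
    show "\<exists>t\<in>carrier R - P. \<exists>u\<in>carrier R - P. t \<otimes> f = ?\<pi> [^] n \<otimes> u"
      using t u eq by blast
    fix m :: nat assume "\<exists>t\<in>carrier R - P. \<exists>u\<in>carrier R - P. t \<otimes> f = ?\<pi> [^] m \<otimes> u"
    then obtain t' u' where tu': "t' \<in> carrier R - P" "u' \<in> carrier R - P" "t' \<otimes> f = ?\<pi> [^] m \<otimes> u'"
      by blast
    show "m = n"
      using not_less[OF t u eq tu'] not_less[OF tu' t u eq] by simp
  qed
qed

lemma val_factorization:
  assumes "P \<in> height_one_primes R" "f \<in> carrier R" "f \<noteq> \<zero>"
  obtains t u where "t \<in> carrier R - P" "u \<in> carrier R - P" "t \<otimes> f = unif R P [^] val R P f \<otimes> u"
proof -
  obtain n t u where tu: "t \<in> carrier R - P" "u \<in> carrier R - P" "t \<otimes> f = unif R P [^] (n::nat) \<otimes> u"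
    using uniformizer_factorization[OF height_one_prime[OF assms(1)] uniformizer_unif[OF assms(1)]
        assms(2,3)] by blast
  then show ?thesis using that val_eqI[OF assms(1,2) tu] by simp
qed

lemma val_mult:
  assumes P: "P \<in> height_one_primes R" and f: "f \<in> carrier R" "f \<noteq> \<zero>" and g: "g \<in> carrier R" "g \<noteq> \<zero>"
  shows "val R P (f \<otimes> g) = val R P f + val R P g"
proof -
  obtain t u where tu: "t \<in> carrier R - P" "u \<in> carrier R - P" "t \<otimes> f = unif R P [^] val R P f \<otimes> u"
    using val_factorization[OF P f] .
  obtain s w where sw: "s \<in> carrier R - P" "w \<in> carrier R - P" "s \<otimes> g = unif R P [^] val R P g \<otimes> w"
    using val_factorization[OF P g] .
  note prime = height_one_prime[OF P] and \<pi> = unif_carrier[OF P]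
  have "(t \<otimes> s) \<otimes> (f \<otimes> g) = (t \<otimes> f) \<otimes> (s \<otimes> g)" using tu(1) sw(1) f g by (simp add: m_ac)
  also have "\<dots> = unif R P [^] (val R P f + val R P g) \<otimes> (u \<otimes> w)"
    unfolding tu(3) sw(3) using tu(2) sw(2) \<pi> by (simp add: m_ac flip: nat_pow_mult)
  finally show ?thesis
    using val_eqI[OF P _ prime_complement_mult[OF prime tu(1) sw(1)]
        prime_complement_mult[OF prime tu(2) sw(2)]] f g by simp
qed

lemma val_not_mem:
  assumes P: "P \<in> height_one_primes R" and f: "f \<in> carrier R - P"
  shows "val R P f = 0"
  using val_eqI[OF P _ prime_complement_one[OF height_one_prime[OF P]] f, where n = 0] f by simp

lemma val_pow:
  assumes "P \<in> height_one_primes R" "f \<in> carrier R" "f \<noteq> \<zero>"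
  shows "val R P (f [^] (n::nat)) = n * val R P f"
proof (induction n)
  case 0
  then show ?case
    using val_not_mem[OF assms(1) prime_complement_one[OF height_one_prime[OF assms(1)]]] by simp
next
  case (Suc n)
  then show ?case using assms val_mult nat_pow_nonzero by simp
qed

lemma val_unif: "P \<in> height_one_primes R \<Longrightarrow> val R P (unif R P) = 1"
  using val_eqI[of P "unif R P" \<one> \<one> 1] prime_complement_one[OF height_one_prime] unif_carrier
  by simp

lemma divides_imp_val_le:
  assumes "P \<in> height_one_primes R" "f \<in> carrier R" "f \<noteq> \<zero>" "g \<in> carrier R" "g divides f"
  shows "val R P g \<le> val R P f"
proof -
  obtain h where h: "h \<in> carrier R" "f = g \<otimes> h" using assms(5) by (auto simp: factor_def)
  then have "g \<noteq> \<zero>" "h \<noteq> \<zero>" using assms(3,4) by auto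
  then show ?thesis using val_mult[OF assms(1,4) _ h(1)] h(2) by simp
qed

lemma val_le_imp_locally_divides:
  assumes P: "P \<in> height_one_primes R" and f: "f \<in> carrier R" "f \<noteq> \<zero>" and g: "g \<in> carrier R" "g \<noteq> \<zero>"
    and le: "val R P g \<le> val R P f"
  shows "\<exists>t\<in>carrier R - P. g divides (t \<otimes> f)"
proof -
  obtain t u where tu: "t \<in> carrier R - P" "u \<in> carrier R - P" "t \<otimes> f = unif R P [^] val R P f \<otimes> u"
    using val_factorization[OF P f] .
  obtain s w where sw: "s \<in> carrier R - P" "w \<in> carrier R - P" "s \<otimes> g = unif R P [^] val R P g \<otimes> w"
    using val_factorization[OF P g] .
  note prime = height_one_prime[OF P] and \<pi> = unif_carrier[OF P]
  obtain k where k: "val R P f = val R P g + k" using le le_Suc_ex by blast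
  have "(w \<otimes> t) \<otimes> f = w \<otimes> (t \<otimes> f)" using tu(1) sw(2) f by (simp add: m_ac)
  also have "\<dots> = (unif R P [^] val R P g \<otimes> w) \<otimes> (unif R P [^] k \<otimes> u)"
    unfolding tu(3) k using tu(2) sw(2) \<pi> by (simp add: m_ac flip: nat_pow_mult)
  also have "\<dots> = g \<otimes> (s \<otimes> (unif R P [^] k \<otimes> u))"
    unfolding sw(3)[symmetric] using sw(1) tu(2) g \<pi> by (simp add: m_ac)
  finally have "g divides ((w \<otimes> t) \<otimes> f)" using sw(1) tu(2) \<pi> by (auto simp: factor_def)
  then show ?thesis using prime_complement_mult[OF prime sw(2) tu(1)] by blast
qed

text \<open>\<open>R\<close> is the intersection of its localizations at the height one primes.\<close>

lemma val_le_imp_divides: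
  assumes f: "f \<in> carrier R" "f \<noteq> \<zero>" and g: "g \<in> carrier R" "g \<noteq> \<zero>"
    and le: "\<And>P. P \<in> height_one_primes R \<Longrightarrow> val R P g \<le> val R P f"
  shows "g divides f"
proof (rule ccontr)
  assume "\<not> g divides f"
  then have "f \<notin> PIdl g" using mem_PIdl_iff[OF g(1)] by simp
  then obtain Q where Q: "Q \<in> Ass_Quot R (PIdl g)" "colon R (PIdl g) f \<subseteq> Q"
    using Ass_Quot_not_mem[OF cgenideal_ideal[OF g(1)] f(1)] by blast
  have QH: "Q \<in> height_one_primes R" using Ass_principal_height_one[OF g Q(1)] .
  obtain t where t: "t \<in> carrier R - Q" "g divides (t \<otimes> f)"
    using val_le_imp_locally_divides[OF QH f g le[OF QH]] by blast
  then have "t \<in> colon R (PIdl g) f" unfolding colon_def using mem_PIdl_iff[OF g(1)] by simp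
  then show False using Q(2) t(1) by blast
qed

text \<open>The divisibility form treats zero uniformly, so closure of \<open>val_ideal\<close>
  under addition follows from a common multiplier, without case distinctions on vanishing
  sums.\<close>

lemma mem_val_ideal_iff:
  assumes P: "P \<in> height_one_primes R" and f: "f \<in> carrier R"
  shows "f \<in> val_ideal R P n \<longleftrightarrow> (\<exists>t\<in>carrier R - P. unif R P [^] n divides (t \<otimes> f))"
proof (cases "f = \<zero>")
  case True
  have "unif R P [^] n divides (\<one> \<otimes> f)"
    using True unif_carrier[OF P] by (auto simp: factor_def intro!: bexI[of _ \<zero>])
  moreover have "f \<in> val_ideal R P n" using True by (simp add: val_ideal_def)
  ultimately show ?thesis using prime_complement_one[OF height_one_prime[OF P]] by blast
next
  case False
  note \<pi> = unif_carrier[OF P] unif_nonzero[OF P]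
  have \<pi>n: "unif R P [^] n \<in> carrier R" "unif R P [^] n \<noteq> \<zero>" "val R P (unif R P [^] n) = n"
    using \<pi> nat_pow_nonzero val_pow[OF P \<pi>] val_unif[OF P] by auto
  have "n \<le> val R P f" if t: "t \<in> carrier R - P" "unif R P [^] n divides (t \<otimes> f)" for t
  proof -
    have tnz: "t \<noteq> \<zero>" using prime_complement_nonzero[OF height_one_prime[OF P] t(1)] .
    have "n \<le> val R P (t \<otimes> f)"
      using divides_imp_val_le[OF P _ _ \<pi>n(1) t(2)] \<pi>n(3) t(1) f False tnz integral_iff by auto
    then show ?thesis using val_mult[OF P _ tnz f False] val_not_mem[OF P t(1)] t(1) by simp
  qed
  then show ?thesis
    using val_le_imp_locally_divides[OF P f False \<pi>n(1,2)] \<pi>n(3) f False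
    by (auto simp: val_ideal_def)
qed

lemma val_ideal_ideal:
  assumes P: "P \<in> height_one_primes R"
  shows "ideal (val_ideal R P n) R"
proof -
  let ?V = "val_ideal R P n"
  note iff = mem_val_ideal_iff[OF P, of _ n] and prime = height_one_prime[OF P]
  note \<pi> = nat_pow_closed[OF unif_carrier[OF P], of n]
  have sub: "?V \<subseteq> carrier R" by (auto simp: val_ideal_def)
  have l_closed: "x \<otimes> a \<in> ?V" if a: "a \<in> ?V" and x: "x \<in> carrier R" for a x
  proof -
    obtain t r where t: "t \<in> carrier R - P" "r \<in> carrier R" "t \<otimes> a = unif R P [^] n \<otimes> r"
      using iff[of a] a sub by (auto simp: factor_def)
    have "t \<otimes> (x \<otimes> a) = x \<otimes> (t \<otimes> a)" using t(1) x a sub by (auto simp: m_ac)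
    also have "\<dots> = unif R P [^] n \<otimes> (x \<otimes> r)" unfolding t(3) using t(2) x \<pi> by (simp add: m_ac)
    finally show ?thesis using iff[of "x \<otimes> a"] t x a sub by (auto simp: factor_def)
  qed
  have a_closed: "a \<oplus> b \<in> ?V" if a: "a \<in> ?V" and b: "b \<in> ?V" for a b
  proof -
    obtain t r where t: "t \<in> carrier R - P" "r \<in> carrier R" "t \<otimes> a = unif R P [^] n \<otimes> r"
      using iff[of a] a sub by (auto simp: factor_def)
    obtain t' r' where t': "t' \<in> carrier R - P" "r' \<in> carrier R" "t' \<otimes> b = unif R P [^] n \<otimes> r'"
      using iff[of b] b sub by (auto simp: factor_def)
    have ab: "a \<in> carrier R" "b \<in> carrier R" using a b sub by auto
    have "(t \<otimes> t') \<otimes> (a \<oplus> b) = t' \<otimes> (t \<otimes> a) \<oplus> t \<otimes> (t' \<otimes> b)"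
      using t(1) t'(1) ab by (simp add: r_distr m_ac)
    also have "\<dots> = unif R P [^] n \<otimes> (t' \<otimes> r \<oplus> t \<otimes> r')"
      unfolding t(3) t'(3) using t(1,2) t'(1,2) \<pi> by (simp add: r_distr m_ac)
    finally have "unif R P [^] n divides ((t \<otimes> t') \<otimes> (a \<oplus> b))"
      using t(1,2) t'(1,2) by (auto simp: factor_def)
    then show ?thesis
      using iff[of "a \<oplus> b"] ab prime_complement_mult[OF prime t(1) t'(1)] by blast
  qed
  show ?thesis
  proof (rule idealI[OF ring_axioms])
    show "subgroup ?V (add_monoid R)"
    proof (unfold_locales, goal_cases)
      case (4 x)
      then have "x \<in> carrier R" using sub by auto
      then have "\<ominus> x = (\<ominus> \<one>) \<otimes> x" by (simp add: l_minus)
      then show ?case using l_closed[OF 4, of "\<ominus> \<one>"] by (simp add: a_inv_def[symmetric])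
    qed (use sub a_closed in \<open>auto simp: val_ideal_def\<close>)
    show "x \<otimes> a \<in> ?V" if "a \<in> ?V" "x \<in> carrier R" for a x using l_closed that .
    then show "a \<otimes> x \<in> ?V" if "a \<in> ?V" "x \<in> carrier R" for a x
      using that sub m_comm[of a x] by auto
  qed
qed

lemma val_ideal_mult:
  assumes "P \<in> height_one_primes R" "f \<in> val_ideal R P m" "g \<in> val_ideal R P n"
  shows "f \<otimes> g \<in> val_ideal R P (m + n)"
proof (cases "f = \<zero> \<or> g = \<zero>")
  case True
  then show ?thesis using assms(2,3) by (auto simp: val_ideal_def)
next
  case False
  then show ?thesis using assms(2,3) val_mult[OF assms(1), of f g] by (auto simp: val_ideal_def)
qed

lemma prime_val_ideal:
  assumes P: "P \<in> height_one_primes R"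
  shows "P \<subseteq> val_ideal R P 1"
proof
  fix p assume p: "p \<in> P"
  interpret P: primeideal P R by (rule height_one_prime[OF P])
  show "p \<in> val_ideal R P 1"
    using uniformizer_unif[OF P] p mem_val_ideal_iff[OF P P.Icarr[OF p], of 1] unif_carrier[OF P]
    unfolding uniformizer_def by auto
qed

end


subsection \<open>Symbolic powers\<close>

context cring
begin

lemma ideal_power_0: "ideal_power R I 0 = carrier R"
  by (simp add: ideal_power_def nat_pow_def ideals_set_def)

lemma ideal_power_Suc: "ideal_power R I (Suc n) = ideal_prod R (ideal_power R I n) I"
  by (simp add: ideal_power_def nat_pow_def ideals_set_def)

lemma ideal_power_ideal: "ideal I R \<Longrightarrow> ideal (ideal_power R I n) R"
  by (induction n) (simp_all add: ideal_power_0 ideal_power_Suc oneideal ideal_prod_is_ideal)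

lemma nat_pow_mem_ideal_power: "f \<in> I \<Longrightarrow> ideal I R \<Longrightarrow> f [^] n \<in> ideal_power R I n"
  by (induction n) (auto simp: ideal_power_0 ideal_power_Suc intro: ideal_prod.prod)

lemma Ass_Quot_primeideal:
  assumes "primeideal P R"
  shows "Ass_Quot R P = {P}"
proof -
  interpret P: primeideal P R by fact
  have "colon R P x = (if x \<in> P then carrier R else P)" if "x \<in> carrier R" for x
    using that P.I_prime P.I_l_closed P.I_r_closed P.Icarr by (auto simp: colon_def)
  moreover have "\<not> primeideal (carrier R) R" using primeideal.I_notcarr by blast
  moreover have "\<one> \<notin> P" using P.one_imp_carrier P.I_notcarr by auto
  ultimately show ?thesis
    using Ass_Quot_iff[OF P.is_ideal] assms by (auto split: if_splits intro!: bexI[of _ \<one>])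
qed

end

text \<open>The fractions with numerator in \<open>J\<close> form an ideal \<open>E\<close>
  containing the image of \<open>J\<close>, so every element of the generated ideal is a single
  fraction of this kind.\<close>

lemma (in mult_set) loc_map_mem_genideal_iff:
  assumes J: "ideal J R" and x: "x \<in> carrier R"
  shows "loc_map R W x \<in> genideal (localization R W) (loc_map R W ` J) \<longleftrightarrow> (\<exists>w\<in>W. w \<otimes> x \<in> J)"
proof -
  let ?L = "localization R W"
  interpret L: cring ?L by (rule cring_localization)
  interpret J: ideal J R by (rule J)
  have img: "loc_map R W ` J \<subseteq> carrier ?L"
    using loc_map_hom J.Icarr by (auto simp: ring_hom_def)
  define E where "E = {loc_frac R W i w | i w. i \<in> J \<and> w \<in> W}"
  have l_closed: "y \<otimes>\<^bsub>?L\<^esub> e \<in> E" if e: "e \<in> E" and y: "y \<in> carrier ?L" for e y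
  proof -
    obtain i w where i: "e = loc_frac R W i w" "i \<in> J" "w \<in> W" using e E_def by blast
    obtain r s where r: "y = loc_frac R W r s" "r \<in> carrier R" "s \<in> W" using y carrier_loc by blast
    have "y \<otimes>\<^bsub>?L\<^esub> e = loc_frac R W (r \<otimes> i) (s \<otimes> w)"
      unfolding i(1) r(1) using i r J.Icarr by (intro loc_mult) auto
    then show ?thesis using E_def J.I_l_closed i r m_closed by blast
  qed
  have sub: "E \<subseteq> carrier ?L" unfolding E_def carrier_loc using J.Icarr by blast
  have "ideal E ?L"
  proof (rule idealI[OF L.ring_axioms])
    show "subgroup E (add_monoid ?L)"
    proof (unfold_locales, goal_cases)
      case 1
      then show ?case using sub by simp
    next
      case (2 d e)
      obtain i w where i: "e = loc_frac R W i w" "i \<in> J" "w \<in> W" using 2 E_def by blast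
      obtain j v where j: "d = loc_frac R W j v" "j \<in> J" "v \<in> W" using 2 E_def by blast
      have "d \<oplus>\<^bsub>?L\<^esub> e = loc_frac R W (w \<otimes> j \<oplus> v \<otimes> i) (v \<otimes> w)"
        unfolding i(1) j(1) using i j J.Icarr by (intro loc_add) auto
      moreover have "w \<otimes> j \<oplus> v \<otimes> i \<in> J" using i j W_carr J.I_l_closed J.a_closed by auto
      ultimately show ?case using E_def i j m_closed by auto
    next
      case 3
      have "loc_frac R W \<zero> \<one> \<in> E" unfolding E_def using J.zero_closed one_closed by blast
      then show ?case by (simp add: zero_loc)
    next
      case (4 e)
      then have "e \<in> carrier ?L" using sub by auto
      then have "\<ominus>\<^bsub>?L\<^esub> e = (\<ominus>\<^bsub>?L\<^esub> \<one>\<^bsub>?L\<^esub>) \<otimes>\<^bsub>?L\<^esub> e" by (simp add: L.l_minus)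
      then have "\<ominus>\<^bsub>?L\<^esub> e \<in> E" using l_closed[OF 4, of "\<ominus>\<^bsub>?L\<^esub> \<one>\<^bsub>?L\<^esub>"] by simp
      then show ?case by (simp only: a_inv_def)
    qed
    show "y \<otimes>\<^bsub>?L\<^esub> e \<in> E" if "e \<in> E" "y \<in> carrier ?L" for e y using l_closed that .
    then show "e \<otimes>\<^bsub>?L\<^esub> y \<in> E" if "e \<in> E" "y \<in> carrier ?L" for e y
      using that sub L.m_comm[of e y] by auto
  qed
  moreover have "loc_map R W ` J \<subseteq> E" unfolding loc_map_def E_def using one_closed by blast
  ultimately have gen: "genideal ?L (loc_map R W ` J) \<subseteq> E" by (rule L.genideal_minimal)
  show ?thesis
  proof
    assume "loc_map R W x \<in> genideal ?L (loc_map R W ` J)"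
    then obtain i w where i: "loc_frac R W x \<one> = loc_frac R W i w" "i \<in> J" "w \<in> W"
      using gen unfolding loc_map_def E_def by blast
    then obtain u where u: "u \<in> W" "u \<otimes> (w \<otimes> x) = u \<otimes> (\<one> \<otimes> i)"
      using loc_frac_eq_iff[of x i \<one> w] x J.Icarr one_closed by auto
    \<comment> \<open>The multiplier is \<open>u \<otimes> w\<close> rather than \<open>w\<close>,
      because equality of fractions holds only up to a factor \<open>u\<close> from
      \<open>W\<close>.\<close>
    then have "(u \<otimes> w) \<otimes> x = u \<otimes> i" using x i u J.Icarr W_carr by (simp add: m_assoc)
    then show "\<exists>w\<in>W. w \<otimes> x \<in> J" using u(1) i J.I_l_closed W_carr m_closed by metis
  next
    assume "\<exists>w\<in>W. w \<otimes> x \<in> J"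
    then obtain w where w: "w \<in> W" "w \<otimes> x \<in> J" by blast
    interpret G: ideal "genideal ?L (loc_map R W ` J)" ?L by (rule L.genideal_ideal[OF img])
    have "loc_map R W (w \<otimes> x) \<in> genideal ?L (loc_map R W ` J)"
      using L.genideal_self[OF img] w(2) by blast
    moreover have "loc_frac R W \<one> w \<in> carrier ?L"
      unfolding carrier_loc using w(1) W_carr[OF one_closed] by blast
    ultimately have "loc_frac R W \<one> w \<otimes>\<^bsub>?L\<^esub> loc_map R W (w \<otimes> x) \<in> genideal ?L (loc_map R W ` J)"
      by (rule G.I_l_closed)
    also have "loc_frac R W \<one> w \<otimes>\<^bsub>?L\<^esub> loc_map R W (w \<otimes> x) = loc_frac R W (\<one> \<otimes> (w \<otimes> x)) (w \<otimes> \<one>)"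
      unfolding loc_map_def using w(1) x W_carr one_closed by (intro loc_mult) auto
    also have "\<dots> = loc_map R W x"
      unfolding loc_map_def using w(1) x W_carr one_closed by (intro loc_frac_eqI) auto
    finally show "loc_map R W x \<in> genideal ?L (loc_map R W ` J)" .
  qed
qed

text \<open>From here on, symbolic powers are handled by multipliers in \<open>R\<close> instead of
  the localized ring.\<close>

lemma (in cring) mem_symbolic_power_iff:
  assumes "ideal I R"
  shows "x \<in> symbolic_power R I n \<longleftrightarrow>
    x \<in> carrier R \<and> (\<exists>w\<in>carrier R - \<Union>(Ass_Quot R I). w \<otimes> x \<in> ideal_power R I n)"
proof -
  have "mult_set R (carrier R - \<Union>(Ass_Quot R I))"
    by (intro mult_set.intro is_cring Ass_complement_submonoid)
  then show ?thesis
    using mult_set.loc_map_mem_genideal_iff[OF _ ideal_power_ideal[OF assms]]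
    by (simp add: symbolic_power_def Let_def cong: conj_cong)
qed

context noetherian_normal_domain
begin

lemma ideal_power_val_ideal:
  assumes P: "P \<in> height_one_primes R" and I: "I \<subseteq> val_ideal R P n"
  shows "ideal_power R I a \<subseteq> val_ideal R P (a * n)"
proof (induction a)
  case 0
  then show ?case by (auto simp: ideal_power_0 val_ideal_def)
next
  case (Suc a)
  interpret V: ideal "val_ideal R P (Suc a * n)" R by (rule val_ideal_ideal[OF P])
  show ?case
  proof
    fix x assume "x \<in> ideal_power R I (Suc a)"
    then have "x \<in> ideal_prod R (ideal_power R I a) I" by (simp add: ideal_power_Suc)
    then show "x \<in> val_ideal R P (Suc a * n)"
    proof induction
      case (prod i j)
      then show ?case using val_ideal_mult[OF P, of i "a * n" j n] Suc I by (auto simp: add.commute)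
    next
      case (sum s1 s2)
      then show ?case by (simp only: V.a_closed)
    qed
  qed
qed

lemma val_mult_complement:
  assumes P: "P \<in> height_one_primes R" and w: "w \<in> carrier R - P" and x: "x \<in> carrier R"
    and wx: "w \<otimes> x \<in> val_ideal R P n"
  shows "x \<in> val_ideal R P n"
proof (cases "x = \<zero>")
  case True
  then show ?thesis by (simp add: val_ideal_def)
next
  case False
  have wnz: "w \<noteq> \<zero>" using prime_complement_nonzero[OF height_one_prime[OF P] w] .
  then have "w \<otimes> x \<noteq> \<zero>" using False w x integral_iff by auto
  then show ?thesis
    using wx x val_mult[OF P _ wnz x False] val_not_mem[OF P w] w by (auto simp: val_ideal_def)
qed

text \<open>Elements of \<open>P\<close> have order at least 1 and multipliers outside
  \<open>P\<close> have order 0, which bounds the order from below. Conversely, an element of order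
  at least \<open>n\<close> has a multiple \<open>t \<otimes> x\<close> divisible by the
  \<open>n\<close>-th power of the uniformizer, which lies in the ordinary power.\<close>

lemma symbolic_power_prime:
  assumes P: "P \<in> height_one_primes R"
  shows "symbolic_power R P n = val_ideal R P n"
proof -
  interpret P: primeideal P R by (rule height_one_prime[OF P])
  interpret Pn: ideal "ideal_power R P n" R by (rule ideal_power_ideal[OF P.is_ideal])
  have iff: "x \<in> symbolic_power R P n \<longleftrightarrow>
      x \<in> carrier R \<and> (\<exists>w\<in>carrier R - P. w \<otimes> x \<in> ideal_power R P n)" for x
    using mem_symbolic_power_iff[OF P.is_ideal] Ass_Quot_primeideal[OF P.primeideal] by simp
  have sub: "ideal_power R P n \<subseteq> val_ideal R P n"
    using ideal_power_val_ideal[OF P prime_val_ideal[OF P], of n] by simp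
  show ?thesis
  proof (intro equalityI subsetI)
    fix x assume "x \<in> symbolic_power R P n"
    then show "x \<in> val_ideal R P n" using iff val_mult_complement[OF P] sub by blast
  next
    fix x assume x: "x \<in> val_ideal R P n"
    then have xc: "x \<in> carrier R" by (simp add: val_ideal_def)
    obtain t where t: "t \<in> carrier R - P" "unif R P [^] n divides (t \<otimes> x)"
      using mem_val_ideal_iff[OF P xc] x by blast
    have "unif R P [^] n \<in> ideal_power R P n"
      by (rule nat_pow_mem_ideal_power[OF unif_mem[OF P] P.is_ideal])
    then have "t \<otimes> x \<in> ideal_power R P n" using t(2) Pn.I_r_closed by (auto simp: factor_def)
    then show "x \<in> symbolic_power R P n" using iff xc t(1) by blast
  qed
qed


subsection \<open>Divisors\<close>

text \<open>Distinct height one primes are incomparable, so each \<open>Q\<close> in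
  \<open>S\<close> contains some \<open>z\<close> outside \<open>P\<close>; \<open>e\<close> is a
  product of powers of these. It raises the orders on \<open>S\<close> while keeping order 0 at
  \<open>P\<close>.\<close>

lemma avoid_height_one:
  assumes "finite S" "S \<subseteq> height_one_primes R" "P \<in> height_one_primes R" "P \<notin> S"
  shows "\<exists>e\<in>carrier R - P. \<forall>Q\<in>S. e \<in> val_ideal R Q (n Q)"
  using assms(1,2,4)
proof induction
  case empty
  then show ?case using prime_complement_one[OF height_one_prime[OF assms(3)]] by blast
next
  case (insert Q S)
  then obtain e where e: "e \<in> carrier R - P" "\<And>Q. Q \<in> S \<Longrightarrow> e \<in> val_ideal R Q (n Q)" by auto
  have Q: "Q \<in> height_one_primes R" "Q \<noteq> P" using insert by auto
  note prime = height_one_prime[OF assms(3)]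
  interpret Q: primeideal Q R by (rule height_one_prime[OF Q(1)])
  have "\<not> Q \<subseteq> P" using height_one_subset_eq[OF assms(3) Q(1)] Q(2) by blast
  then obtain z where z: "z \<in> Q" "z \<notin> P" by blast
  have zc: "z \<in> carrier R" using Q.Icarr z by blast
  have z': "z [^] n Q \<in> carrier R - P"
    using zc z prime_nat_pow_mem[OF prime zc] by auto
  have "z \<noteq> \<zero>" using prime_complement_nonzero[OF prime, of z] z zc by auto
  then have "z [^] n Q \<in> val_ideal R Q (n Q)"
    using val_pow[OF Q(1) zc, of "n Q"] prime_val_ideal[OF Q(1)] z zc by (auto simp: val_ideal_def)
  then have "e \<otimes> z [^] n Q \<in> val_ideal R Q (n Q)"
    using ideal.I_l_closed[OF val_ideal_ideal[OF Q(1)]] e by blast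
  moreover have "e \<otimes> z [^] n Q \<in> val_ideal R Q' (n Q')" if "Q' \<in> S" for Q'
    using ideal.I_r_closed[OF val_ideal_ideal e(2)[OF that]] that insert.prems z' by auto
  ultimately show ?case using prime_complement_mult[OF prime e(1) z'] by blast
qed

text \<open>The generator \<open>f\<close> divides every element of the divisor ideal, and at each
  height one prime some element has exactly the prescribed order: a power of the uniformizer times
  an \<open>e\<close> from \<open>avoid_height_one\<close>. This bounds the order of
  \<open>f\<close> from above at all height one primes, also where the coefficient is 0; membership
  of \<open>f\<close> in the ideal gives the lower bound on the support.\<close>

lemma principal_relation_val:
  assumes c: "c \<in> principal_relations R"
  shows "\<exists>f\<in>carrier R - {\<zero>}. \<forall>P\<in>height_one_primes R. Poly_Mapping.lookup c P = int (val R P f)"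
proof -
  let ?m = "\<lambda>P. nat (Poly_Mapping.lookup c P)"
  have keys: "Poly_Mapping.keys c \<subseteq> height_one_primes R"
    and pos: "\<And>P. P \<in> Poly_Mapping.keys c \<Longrightarrow> Poly_Mapping.lookup c P > 0"
    and principal: "principalideal (divisor_ideal R c) R"
    using c by (auto simp: principal_relations_def)
  have mem: "x \<in> divisor_ideal R c \<longleftrightarrow>
      x \<in> carrier R \<and> (\<forall>P\<in>Poly_Mapping.keys c. x \<in> val_ideal R P (?m P))" for x
    using symbolic_power_prime[OF subsetD[OF keys]] by (auto simp: divisor_ideal_def)
  obtain f where f: "f \<in> carrier R" "divisor_ideal R c = PIdl f"
    using principalideal.generate[OF principal] cgenideal_eq_genideal by auto
  have exact: "\<exists>x\<in>divisor_ideal R c. x \<noteq> \<zero> \<and> val R P x = ?m P" if P: "P \<in> height_one_primes R" for P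
  proof -
    obtain e where e: "e \<in> carrier R - P" "\<And>Q. Q \<in> Poly_Mapping.keys c - {P} \<Longrightarrow> e \<in> val_ideal R Q (?m Q)"
      using avoid_height_one[of "Poly_Mapping.keys c - {P}" P ?m] P keys by auto
    define y where "y = unif R P [^] ?m P"
    have y: "y \<in> carrier R" "y \<noteq> \<zero>" "val R P y = ?m P"
      unfolding y_def
      using unif_carrier[OF P] unif_nonzero[OF P] nat_pow_nonzero val_pow[OF P] val_unif[OF P] by auto
    have enz: "e \<noteq> \<zero>" using prime_complement_nonzero[OF height_one_prime[OF P] e(1)] .
    have val: "val R P (y \<otimes> e) = ?m P"
      using val_mult[OF P y(1,2) _ enz] e(1) y(3) val_not_mem[OF P e(1)] by simp
    have "y \<otimes> e \<in> val_ideal R Q (?m Q)" if Q: "Q \<in> Poly_Mapping.keys c" for Q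
    proof (cases "Q = P")
      case True
      then show ?thesis using val y e by (simp add: val_ideal_def)
    next
      case False
      then show ?thesis
        using ideal.I_l_closed[OF val_ideal_ideal] e(2)[of Q] y(1) keys Q by blast
    qed
    then have "y \<otimes> e \<in> divisor_ideal R c" unfolding mem using y e by auto
    moreover have "y \<otimes> e \<noteq> \<zero>" using y enz e integral_iff by auto
    ultimately show ?thesis using val by blast
  qed
  have "f \<noteq> \<zero>"
  proof
    assume "f = \<zero>"
    then have zero: "divisor_ideal R c = {\<zero>}" using f genideal_zero cgenideal_eq_genideal by auto
    \<comment> \<open>\<open>exact\<close> needs a height one prime to start from; with empty
      support the divisor ideal is \<open>R\<close> and contains \<open>\<one>\<close>.\<close>
    show False
    proof (cases "Poly_Mapping.keys c = {}")
      case True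
      then have "\<one> \<in> divisor_ideal R c" by (simp only: mem) simp
      then show False using zero by simp
    next
      case False
      then show False using exact keys zero by blast
    qed
  qed
  moreover have "Poly_Mapping.lookup c P = int (val R P f)" if P: "P \<in> height_one_primes R" for P
  proof -
    obtain x where x: "x \<in> divisor_ideal R c" "x \<noteq> \<zero>" "val R P x = ?m P" using exact[OF P] by blast
    have xc: "x \<in> carrier R" "f divides x" using x(1) f mem mem_PIdl_iff by auto
    have le: "val R P f \<le> ?m P" using divides_imp_val_le[OF P xc(1) x(2) f(1) xc(2)] x(3) by simp
    show ?thesis
    proof (cases "P \<in> Poly_Mapping.keys c")
      case True
      have "f \<in> divisor_ideal R c" using f cgenideal_self by simp
      then have "?m P \<le> val R P f" using mem True \<open>f \<noteq> \<zero>\<close> by (auto simp: val_ideal_def)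
      then show ?thesis using le pos[OF True] by simp
    next
      case False
      then show ?thesis using le by (simp add: in_keys_iff)
    qed
  qed
  ultimately show ?thesis using f(1) by blast
qed

text \<open>The relations themselves are effective divisors, but inverses in the generated subgroup
  bring in denominators; \<open>f\<close> and \<open>g\<close> are numerator and denominator of a
  fraction with divisor \<open>c\<close>.\<close>

lemma generated_relation_val:
  assumes "c \<in> generate (free_Abelian_group (height_one_primes R)) (principal_relations R)"
  shows "\<exists>f\<in>carrier R - {\<zero>}. \<exists>g\<in>carrier R - {\<zero>}. \<forall>P\<in>height_one_primes R.
    Poly_Mapping.lookup c P = int (val R P f) - int (val R P g)"
  using assms
proof induction
  case one
  then show ?case by (intro bexI[of _ \<one>]) auto
next
  case (incl h)
  then obtain f where "f \<in> carrier R - {\<zero>}"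
    "\<And>P. P \<in> height_one_primes R \<Longrightarrow> Poly_Mapping.lookup h P = int (val R P f)"
    using principal_relation_val by blast
  then show ?case
    using val_not_mem[OF _ prime_complement_one[OF height_one_prime]]
    by (intro bexI[of _ f] bexI[of _ \<one>]) auto
next
  case (inv h)
  then obtain f where "f \<in> carrier R - {\<zero>}"
    "\<And>P. P \<in> height_one_primes R \<Longrightarrow> Poly_Mapping.lookup h P = int (val R P f)"
    using principal_relation_val by blast
  moreover have "Poly_Mapping.keys h \<subseteq> height_one_primes R"
    using inv by (simp add: principal_relations_def)
  ultimately show ?case
    using val_not_mem[OF _ prime_complement_one[OF height_one_prime]]
    by (intro bexI[of _ \<one>] bexI[of _ f]) auto
next
  case (eng h1 h2)
  obtain f1 g1 where 1: "f1 \<in> carrier R - {\<zero>}" "g1 \<in> carrier R - {\<zero>}"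
    "\<And>P. P \<in> height_one_primes R \<Longrightarrow> Poly_Mapping.lookup h1 P = int (val R P f1) - int (val R P g1)"
    using eng.IH(1) by blast
  obtain f2 g2 where 2: "f2 \<in> carrier R - {\<zero>}" "g2 \<in> carrier R - {\<zero>}"
    "\<And>P. P \<in> height_one_primes R \<Longrightarrow> Poly_Mapping.lookup h2 P = int (val R P f2) - int (val R P g2)"
    using eng.IH(2) by blast
  have "Poly_Mapping.lookup (h1 \<otimes>\<^bsub>free_Abelian_group (height_one_primes R)\<^esub> h2) P =
      int (val R P (f1 \<otimes> f2)) - int (val R P (g1 \<otimes> g2))" if "P \<in> height_one_primes R" for P
    using 1(1,2) 2(1,2) 1(3)[OF that] 2(3)[OF that] val_mult[OF that] by (simp add: lookup_add)
  moreover have "f1 \<otimes> f2 \<in> carrier R - {\<zero>}" "g1 \<otimes> g2 \<in> carrier R - {\<zero>}"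
    using 1 2 by (auto simp: integral_iff)
  ultimately show ?case by blast
qed

text \<open>Lagrange's theorem only makes \<open>D\<close> times \<open>c\<close> the divisor of a
  fraction f/g. Its coefficients are nonnegative, so \<open>g\<close> divides \<open>f\<close> and
  the quotient \<open>h\<close> lies in \<open>R\<close>.\<close>

lemma class_group_multiple_val:
  assumes "Poly_Mapping.keys c \<subseteq> height_one_primes R"
    and "\<And>P. Poly_Mapping.lookup c P \<ge> 0"
  shows "\<exists>h\<in>carrier R - {\<zero>}. \<forall>P\<in>height_one_primes R.
    int (val R P h) = int (order (class_group R)) * Poly_Mapping.lookup c P"
proof -
  let ?F = "free_Abelian_group (height_one_primes R)"
  define N where "N = generate ?F (principal_relations R)"
  let ?D = "order (class_group R)"
  interpret F: comm_group ?F by (rule abelian_free_Abelian_group)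
  have sub: "subgroup N ?F"
    unfolding N_def by (rule F.generate_is_subgroup) (auto simp: principal_relations_def)
  interpret N: normal N ?F by (rule F.subgroup_imp_normal[OF sub])
  have Cl: "class_group R = ?F Mod N" by (simp add: class_group_def N_def)
  interpret Cl: comm_group "?F Mod N" using comm_group_class_group[of R] unfolding Cl .
  have hom: "(\<lambda>x. N #>\<^bsub>?F\<^esub> x) \<in> hom ?F (?F Mod N)" by (rule N.r_coset_hom_Mod)
  have cF: "c \<in> carrier ?F" using assms(1) by simp
  have "N #>\<^bsub>?F\<^esub> c \<in> carrier (?F Mod N)" using hom cF by (auto simp: hom_def)
  then have "(N #>\<^bsub>?F\<^esub> c) [^]\<^bsub>?F Mod N\<^esub> ?D = \<one>\<^bsub>?F Mod N\<^esub>"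
    unfolding Cl by (rule Cl.pow_order_eq_1)
  then have "N #>\<^bsub>?F\<^esub> (c [^]\<^bsub>?F\<^esub> ?D) = N"
    using hom_nat_pow[OF hom cF F.group_axioms Cl.group_axioms, of ?D] by (simp add: FactGroup_def)
  then have "c [^]\<^bsub>?F\<^esub> ?D \<in> N" using F.coset_join1[OF _ F.nat_pow_closed[OF cF] sub] by blast
  then have "\<exists>f\<in>carrier R - {\<zero>}. \<exists>g\<in>carrier R - {\<zero>}. \<forall>P\<in>height_one_primes R.
      int ?D * Poly_Mapping.lookup c P = int (val R P f) - int (val R P g)"
    using generated_relation_val[of "frag_cmul (int ?D) c"] by (simp add: N_def)
  then obtain f g where fg: "f \<in> carrier R - {\<zero>}" "g \<in> carrier R - {\<zero>}"
    and eq: "\<And>P. P \<in> height_one_primes R \<Longrightarrow>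
      int ?D * Poly_Mapping.lookup c P = int (val R P f) - int (val R P g)"
    by blast
  have "g divides f"
  proof (rule val_le_imp_divides)
    fix P assume "P \<in> height_one_primes R"
    then show "val R P g \<le> val R P f"
      using eq[of P] mult_nonneg_nonneg[of "int ?D" "Poly_Mapping.lookup c P"] assms(2)[of P] by linarith
  qed (use fg in auto)
  then obtain h where h: "h \<in> carrier R" "f = g \<otimes> h" by (auto simp: factor_def)
  then have hnz: "h \<noteq> \<zero>" using fg by auto
  have "int (val R P h) = int ?D * Poly_Mapping.lookup c P" if P: "P \<in> height_one_primes R" for P
    using eq[OF P] val_mult[OF P _ _ h(1) hnz, of g] fg(2) h(2) by simp
  then show ?thesis using h(1) hnz by blast
qed

section \<open>Comparison of symbolic and ordinary powers\<close>

theorem symbolic_power_subset_ideal_power: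
  assumes pure: "pure_height R 1 \<qq>" and fin: "finite (carrier (class_group R))"
  shows "symbolic_power R \<qq> (order (class_group R) * a) \<subseteq> ideal_power R \<qq> a"
proof -
  let ?H = "height_one_primes R" and ?D = "order (class_group R)"
  interpret q: ideal \<qq> R using pure by (simp add: pure_height_def)
  have AssH: "Ass_Quot R \<qq> \<subseteq> ?H"
    using pure Ass_Quot_prime by (auto simp: pure_height_def height_one_primes_def)
  \<comment> \<open>The zero ideal would have {0} among its associated primes, and {0} does not have
    height one.\<close>
  have qnz: "\<qq> \<noteq> {\<zero>}"
  proof
    assume "\<qq> = {\<zero>}"
    then obtain Q where Q: "Q \<in> Ass_Quot R \<qq>" "Q \<subseteq> {\<zero>}"
      using Ass_Quot_below_prime[OF q.is_ideal zeroprimeideal] by auto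
    then have "Q = {\<zero>}" using Ass_Quot_contains[OF q.is_ideal Q(1)] q.zero_closed by blast
    then show False using height_one_nonzero[OF subsetD[OF AssH Q(1)]] by simp
  qed
  have "Ass_Quot R \<qq> \<subseteq> {P \<in> ?H. \<qq> \<subseteq> P}"
    using AssH Ass_Quot_contains[OF q.is_ideal] by blast
  then have finAss: "finite (Ass_Quot R \<qq>)"
    using finite_height_one_over[OF q.is_ideal qnz] finite_subset by blast
  \<comment> \<open>The order of \<qq> at \<open>P\<close> is the least order of a nonzero element;
    the minimum exists because \<qq> is nonzero, and an element attaining it generates \<qq> locally
    at \<open>P\<close>.\<close>
  define n where "n P = (LEAST n. \<exists>z\<in>\<qq> - {\<zero>}. val R P z = n)" for P
  have n_attained: "\<exists>z\<in>\<qq> - {\<zero>}. val R P z = n P" for P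
    unfolding n_def
  proof (rule LeastI_ex)
    show "\<exists>n. \<exists>z\<in>\<qq> - {\<zero>}. val R P z = n" using qnz q.zero_closed by blast
  qed
  have q_val: "\<qq> \<subseteq> val_ideal R P (n P)" for P
  proof
    fix z assume "z \<in> \<qq>"
    then show "z \<in> val_ideal R P (n P)"
      unfolding val_ideal_def n_def using q.Icarr by (auto intro!: Least_le)
  qed
  \<comment> \<open>The value 0 off the associated primes makes the support finite, as a formal sum
    requires, and gives \<open>h\<close> order 0 at the other height one primes, where comparing
    \<open>h [^] a\<close> with \<open>x\<close> becomes trivial.\<close>
  define d where "d P = (if P \<in> Ass_Quot R \<qq> then int (n P) else 0)" for P
  define c where "c = Poly_Mapping.Abs_poly_mapping d"
  have "{P. d P \<noteq> 0} \<subseteq> Ass_Quot R \<qq>" by (auto simp: d_def)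
  then have lookup: "Poly_Mapping.lookup c = d"
    unfolding c_def using finAss finite_subset by (intro lookup_Abs_poly_mapping) blast
  have "P \<in> Ass_Quot R \<qq>" if "P \<in> Poly_Mapping.keys c" for P
    using that unfolding in_keys_iff lookup d_def by presburger
  then have "Poly_Mapping.keys c \<subseteq> ?H" using AssH by blast
  moreover have "d P \<ge> 0" for P by (simp add: d_def)
  ultimately have "\<exists>h\<in>carrier R - {\<zero>}. \<forall>P\<in>?H. int (val R P h) = int ?D * d P"
    using class_group_multiple_val[of c] unfolding lookup by blast
  then obtain h where h: "h \<in> carrier R" "h \<noteq> \<zero>"
    and val_h: "\<And>P. P \<in> ?H \<Longrightarrow> int (val R P h) = int ?D * d P"
    by blast
  interpret Cl: comm_group "class_group R" by (rule comm_group_class_group)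
  \<comment> \<open>Finiteness enters here, since \<open>order\<close> of an infinite group is 0. A
    positive \<open>D\<close> gives \<open>h\<close> order at least \<open>n P\<close> at every
    associated prime, as membership in \<qq> demands.\<close>
  have D: "0 < ?D" unfolding Cl.order_gt_0_iff_finite by (rule fin)
  have val_h_Ass: "val R P h = ?D * n P" if "P \<in> Ass_Quot R \<qq>" for P
    using val_h[of P] that AssH by (simp add: d_def subset_iff flip: of_nat_mult)
  have "h \<in> \<qq>"
  proof (rule ccontr)
    assume "h \<notin> \<qq>"
    then obtain Q where Q: "Q \<in> Ass_Quot R \<qq>" "colon R \<qq> h \<subseteq> Q"
      using Ass_Quot_not_mem[OF q.is_ideal h(1)] by blast
    then have QH: "Q \<in> ?H" using AssH by blast
    \<comment> \<open>Locally at \<open>Q\<close> the element \<open>z\<close> of least order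
      divides \<open>h\<close>, so some multiplier outside \<open>Q\<close> moves \<open>h\<close>
      into \<qq>, against the choice of \<open>Q\<close>.\<close>
    obtain z where z: "z \<in> \<qq>" "z \<noteq> \<zero>" "val R Q z = n Q" using n_attained by blast
    have "val R Q z \<le> val R Q h" using z(3) val_h_Ass[OF Q(1)] D by simp
    then obtain t where t: "t \<in> carrier R - Q" "z divides (t \<otimes> h)"
      using val_le_imp_locally_divides[OF QH h q.Icarr[OF z(1)] z(2)] by blast
    then have "t \<otimes> h \<in> \<qq>" using q.I_r_closed[OF z(1)] by (auto simp: factor_def)
    then show False using t(1) Q(2) by (auto simp: colon_def)
  qed
  then have ha: "h [^] a \<in> ideal_power R \<qq> a" by (rule nat_pow_mem_ideal_power[OF _ q.is_ideal])
  interpret qa: ideal "ideal_power R \<qq> a" R by (rule ideal_power_ideal[OF q.is_ideal])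
  show ?thesis
  proof
    fix x assume "x \<in> symbolic_power R \<qq> (?D * a)"
    then obtain w where x: "x \<in> carrier R" and w: "w \<in> carrier R - \<Union>(Ass_Quot R \<qq>)"
      "w \<otimes> x \<in> ideal_power R \<qq> (?D * a)"
      using mem_symbolic_power_iff[OF q.is_ideal] by blast
    show "x \<in> ideal_power R \<qq> a"
    proof (cases "x = \<zero>")
      case False
      have "h [^] a divides x"
      proof (rule val_le_imp_divides[OF x False])
        fix P assume P: "P \<in> ?H"
        show "val R P (h [^] a) \<le> val R P x"
        proof (cases "P \<in> Ass_Quot R \<qq>")
          case True
          \<comment> \<open>The multiplier \<open>w\<close> avoids all associated primes, so it has
            order 0 at \<open>P\<close> and can be stripped off.\<close>
          have "x \<in> val_ideal R P (?D * a * n P)"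
            using val_mult_complement[OF P _ x] w True ideal_power_val_ideal[OF P q_val] by blast
          then show ?thesis
            using False val_pow[OF P h] val_h_Ass[OF True] by (simp add: val_ideal_def mult_ac)
        next
          case False
          then show ?thesis using val_pow[OF P h] val_h[OF P] by (simp add: d_def)
        qed
      qed (use h nat_pow_nonzero in auto)
      then show ?thesis using qa.I_r_closed[OF ha] by (auto simp: factor_def)
    qed simp
  qed
qed

end

theorem lemma1p1:
  fixes R :: "('a, 'b) ring_scheme"
    and D :: nat
  assumes "noetherian_domain R"
    and "normal_domain R"
    and "finite (carrier (class_group R))"
    and "order (class_group R) = D"
  shows "\<forall>\<qq>. pure_height R 1 \<qq> \<longrightarrow>
           (\<forall>a::nat. a > 0 \<longrightarrow> symbolic_power R \<qq> (D * a) \<subseteq> ideal_power R \<qq> a)"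
proof -
  interpret noetherian_normal_domain R by (intro noetherian_normal_domain.intro assms)
  show ?thesis using symbolic_power_subset_ideal_power assms(3,4) by blast
qed

end
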